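(* Let $T=V_1-V_2$, where $V_1\sim\chi_r'^2(\lambda_1)$ and $V_2\sim\chi_r'^2(\lambda_2)$ are independent, with $r>0$ (real) and $\lambda_1,\lambda_2\geq0$. Let $p_T$ denote the probability density function of $T$. 1. One has $$p_T(x)=\frac{1}{2^{r}}\mathrm{e}^{-(|x|+\lambda_1+\lambda_2)/2}\sum_{k=0}^\infty\sum_{j=0}^k\frac{1}{k!\,\Gamma(r/2+a_{j,k}(x))}\binom{k}{j} \bigg(\frac{\lambda_1}{4}\bigg)^{k-j}\bigg(\frac{\lambda_2}{4}\bigg)^j U\bigg(1-\frac{r}{2}-a_{j,k}(x),\,2-r-k,\,|x|\bigg), \quad x\in\mathbb{R},$$ where $a_{j,k}(x)=k-j$ if $x\geq0$ and $a_{j,k}(x)=j$ if $x<0$. 2. Suppose in addition that $\lambda_1=\lambda_2=\lambda$. Then the density of $T$ can be expressed as the single infinite series $$p_T(x)=\frac{1}{2^r\sqrt{\pi}}\mathrm{e}^{-\lambda}\sum_{k=0}^\infty\frac{(\lambda/4)^k}{k!\,\Gamma(r/2+k)}|x|^{(r-1)/2+k}K_{\frac{r-1}{2}+k}\bigg(\frac{|x|}{2} \bigg),\quad x\in\mathbb{R}.$$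
   Context: For real $r>0$, the noncentral chi-square distribution $\chi_r'^2(\lambda)$ with $r$ degrees of freedom and noncentrality parameter $\lambda>0$ has density $p(x)=\frac{1}{2}\mathrm{e}^{-(x+\lambda)/2}(x/\lambda)^{r/4-1/2}I_{r/2-1}(\sqrt{\lambda x})$, $x\geq0$, where $I_\nu$ is the modified Bessel function of the first kind; $\chi_r'^2(0)$ is the chi-square distribution with $r$ degrees of freedom. (For integer $r$, $\chi_r'^2(\lambda)$ is the law of $\sum_{i=1}^rX_i^2$ with $X_i\sim N(\mu_i,1)$ independent and $\lambda=\sum_{i=1}^r\mu_i^2$.) $U(a,b,x)$ is the confluent hypergeometric function of the second kind (Tricomi's function), $K_\nu(x)$ is the modified Bessel function of the second kind. The convention $0^0=1$ is used.
   Formalization: The formulas are asserted for all real x except x = 0 when r ≤ 1, where the k = 0 terms U(1−r/2, 2−r, 0) and |x|^{(r−1)/2}K_{(r−1)/2}(|x|/2) are infinite; at x = 0 with r > 1 these functions are read as right-hand limits. *)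

theory Defs
  imports "HOL-Probability.Probability"
begin

definition besselI :: "real \<Rightarrow> real \<Rightarrow> real" where
  "besselI \<nu> x = (x / 2) powr \<nu> *
     (\<Sum>k. rGamma (\<nu> + real k + 1) / fact k * (x / 2) ^ (2 * k))"

definition besselK :: "real \<Rightarrow> real \<Rightarrow> real" where
  "besselK \<nu> x = (LBINT t:{0..}. exp (- x * cosh t) * cosh (\<nu> * t))"

definition kummer_solution :: "real \<Rightarrow> real \<Rightarrow> (real \<Rightarrow> real) \<Rightarrow> bool" where
  "kummer_solution a b w \<longleftrightarrow> (\<exists>w' w''. \<forall>x>0.
      (w has_real_derivative w' x) (at x) \<and>
      (w' has_real_derivative w'' x) (at x) \<and>
      x * w'' x + (b - x) * w' x - a * w x = 0)"

text \<open>
  Tricomi's function on the positive half-line, following its standard definition (e.g. DLMF 13.2)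
  as the solution of Kummer's equation that is asymptotic to \<open>x powr (- a)\<close> at infinity. This makes
  sense for all real \<open>a\<close> and \<open>b\<close>, including integer \<open>b\<close>. The behaviour along the positive real axis
  already singles out the solution, because every solution that is not a multiple of it grows like
  \<open>exp x * x powr (a - b)\<close>.
\<close>

definition tricomi_U :: "real \<Rightarrow> real \<Rightarrow> real \<Rightarrow> real" where
  "tricomi_U a b x = (THE y. \<exists>w. kummer_solution a b w \<and>
      w \<sim>[at_top] (\<lambda>t. t powr (- a)) \<and> y = w x)"

text \<open>
  Functions given on the positive half-line are evaluated at \<open>0\<close> by their right-hand limit, if it
  exists.
\<close>

definition at_zero_by_limit :: "(real \<Rightarrow> real) \<Rightarrow> real \<Rightarrow> real" where
  "at_zero_by_limit f x = (if x = 0 then Lim (at_right 0) f else f x)"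

definition chi_square_density :: "real \<Rightarrow> real \<Rightarrow> real" where
  "chi_square_density r x =
     (if x > 0 then x powr (r / 2 - 1) * exp (- x / 2) / (2 powr (r / 2) * Gamma (r / 2)) else 0)"

text \<open>
  The value at the single point \<open>0\<close> (where the density may be infinite) is set to \<open>0\<close>; it does not
  affect the distribution.
\<close>

definition nc_chi_square_density :: "real \<Rightarrow> real \<Rightarrow> real \<Rightarrow> real" where
  "nc_chi_square_density r l x =
     (if l = 0 then chi_square_density r x
      else if x > 0 then 1 / 2 * exp (- (x + l) / 2) * (x / l) powr (r / 4 - 1 / 2)
                           * besselI (r / 2 - 1) (sqrt (l * x))
      else 0)"

definition series_index :: "nat \<Rightarrow> nat \<Rightarrow> real \<Rightarrow> nat" where
  "series_index j k x = (if x \<ge> 0 then k - j else j)"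

end

theory Submission
  imports Defs
begin

text \<open>
  Write \<open>s = r / 2\<close>. Expanding the Bessel function in the density of \<open>V\<^sub>i\<close> turns it into a series
  of gamma densities, \<open>2 powr (-s) * exp (-(x + l)/2) * (\<Sum>k. (l/4)^k / (k! \<Gamma>(s+k)) * x powr (s+k-1))\<close>.
  For \<open>x \<ge> 0\<close> the density of the difference is \<open>\<integral> f\<^sub>1 (v + x) * f\<^sub>2 v dv\<close>. The Cauchy product of the two
  series and Tonelli's theorem (every term is nonnegative) reduce this to the integrals
  \<open>J(\<alpha>,\<beta>)(x) = \<integral>\<^sub>0\<^sup>\<infinity> exp (-v) * (v+x) powr (\<alpha>-1) * v powr (\<beta>-1) dv\<close>
  with \<open>\<alpha> = s+k-j\<close> and \<open>\<beta> = s+j\<close>. For \<open>x < 0\<close> the two densities exchange their roles.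

  For the first formula, \<open>J(\<alpha>,\<beta>)(x) = \<Gamma>(\<beta>) * U(1-\<alpha>, 2-\<alpha>-\<beta>, x)\<close> has to be shown. Integration by parts
  shows that \<open>J\<close> solves Kummer's equation, dominated convergence gives
  \<open>J \<sim> \<Gamma>(\<beta>) * x powr (\<alpha>-1)\<close>, and an argument with the Wronskian (\<open>kummer_solution_unique\<close>)
  shows that there is no other solution with this behaviour at infinity.

  For the second formula, let \<open>D(\<alpha>,\<beta>) = J(\<alpha>,\<beta>) / (\<Gamma>(\<alpha>) \<Gamma>(\<beta>))\<close>. Integration by parts also gives
  \<open>D(\<alpha>+1,\<beta>) + D(\<alpha>,\<beta>+1) = D(\<alpha>+1,\<beta>+1)\<close>, which by induction collapses the inner sum:
  \<open>\<Sum>j\<le>k. (k choose j) * D(s+k-j, s+j) = D(s+k, s+k)\<close> (\<open>sum_choose_gamma_difference\<close>). What remains is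
  the diagonal \<open>D(\<gamma>,\<gamma>)\<close>, which is a Bessel function: \<open>exp (x/2) * x powr \<nu> * K\<^sub>\<nu>(x/2)\<close> with
  \<open>\<nu> = \<gamma> - 1/2\<close> solves the same Kummer equation as \<open>J(\<gamma>,\<gamma>)\<close> and is asymptotic to
  \<open>sqrt \<pi> * x powr (\<gamma>-1)\<close>, so the uniqueness result applies once more (\<open>besselK_eq_shifted_gamma\<close>).

  The formulas at \<open>x = 0\<close>, \<open>r > 1\<close> follow from the right continuity of \<open>J(\<alpha>,\<beta>)\<close> at \<open>0\<close> for
  \<open>\<alpha> + \<beta> > 1\<close>.
\<close>

section \<open>Limits and derivatives of parametric integrals\<close>

text \<open>
  A filter \<open>at a within S\<close> on the reals is determined by the sequences that converge to it, so the
  sequential dominated convergence theorem suffices.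
\<close>

lemma dominated_convergence_at_within:
  fixes f :: "real \<Rightarrow> 'a \<Rightarrow> real"
  assumes meas: "\<And>t. f t \<in> borel_measurable M" "g \<in> borel_measurable M"
    and dom: "integrable M w"
    and bound: "\<forall>\<^sub>F t in at a within S. AE v in M. \<bar>f t v\<bar> \<le> w v"
    and lim: "AE v in M. ((\<lambda>t. f t v) \<longlongrightarrow> g v) (at a within S)"
  shows "((\<lambda>t. integral\<^sup>L M (f t)) \<longlongrightarrow> integral\<^sup>L M g) (at a within S)"
  unfolding tendsto_at_iff_sequentially comp_def
proof safe
  fix X :: "nat \<Rightarrow> real"
  assume X: "\<forall>i. X i \<in> S - {a}" "X \<longlonglongrightarrow> a"
  then have F: "filterlim X (at a within S) sequentially"
    by (auto simp: filterlim_at eventually_sequentially)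
  from filterlim_iff[THEN iffD1, OF F, rule_format, OF bound]
  obtain N where N: "\<And>n. N \<le> n \<Longrightarrow> AE v in M. \<bar>f (X n) v\<bar> \<le> w v"
    by (auto simp: eventually_sequentially)
  show "(\<lambda>n. integral\<^sup>L M (f (X n))) \<longlonglongrightarrow> integral\<^sup>L M g"
  proof (rule LIMSEQ_offset, rule integral_dominated_convergence)
    show "AE v in M. norm (f (X (n + N)) v) \<le> w v" for n
      using N[of "n + N"] by simp
    show "AE v in M. (\<lambda>n. f (X (n + N)) v) \<longlonglongrightarrow> g v"
      using lim by eventually_elim (rule LIMSEQ_ignore_initial_segment, rule filterlim_compose[OF _ F])
  qed (use meas dom in auto)
qed

text \<open>
  By the mean value theorem, the bound \<open>g\<close> on the derivative also bounds the difference quotients,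
  to which dominated convergence applies.
\<close>

lemma has_real_derivative_integral:
  fixes f f' :: "real \<Rightarrow> 'a \<Rightarrow> real"
  assumes e: "e > 0"
    and int: "\<And>x. \<bar>x - x0\<bar> < e \<Longrightarrow> integrable M (f x)"
    and der: "\<And>x v. \<bar>x - x0\<bar> < e \<Longrightarrow> v \<in> space M \<Longrightarrow>
                ((\<lambda>x. f x v) has_real_derivative f' x v) (at x)"
    and bound: "\<And>x v. \<bar>x - x0\<bar> < e \<Longrightarrow> v \<in> space M \<Longrightarrow> \<bar>f' x v\<bar> \<le> g v"
    and dom: "integrable M g"
    and meas: "f' x0 \<in> borel_measurable M"
  shows "((\<lambda>x. integral\<^sup>L M (f x)) has_real_derivative integral\<^sup>L M (f' x0)) (at x0)"
proof -
  \<comment> \<open>The difference quotient, cut off to make it measurable for every \<open>h\<close>.\<close>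
  define q where "q = (\<lambda>h v. if \<bar>h\<bar> < e then (f (x0 + h) v - f x0 v) / h else 0)"
  have ev: "\<forall>\<^sub>F h in at 0. \<bar>h\<bar> < e"
    using e by (auto simp: eventually_at intro!: exI[of _ e])
  have ne: "\<forall>\<^sub>F h in at (0::real). h \<noteq> 0"
    by (simp add: eventually_at_filter)
  have "((\<lambda>h. integral\<^sup>L M (q h)) \<longlongrightarrow> integral\<^sup>L M (f' x0)) (at 0)"
  proof (rule dominated_convergence_at_within[OF _ meas dom])
    show "q h \<in> borel_measurable M" for h
    proof (cases "\<bar>h\<bar> < e")
      case True
      with int[of "x0 + h"] int[of x0] e show ?thesis
        by (auto simp: q_def cong: measurable_cong)
    qed (simp add: q_def)
    have *: "\<bar>q h v\<bar> \<le> g v" if h: "h \<noteq> 0" "\<bar>h\<bar> < e" and v: "v \<in> space M" for h v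
    proof -
      have "\<bar>f (x0 + h) v - f x0 v\<bar> \<le> g v * \<bar>(x0 + h) - x0\<bar>"
      proof (rule field_differentiable_bound[where S="{x. \<bar>x - x0\<bar> < e}" and f' = "\<lambda>x. f' x v", unfolded real_norm_def])
        have "{x. \<bar>x - x0\<bar> < e} = ball x0 e" by (auto simp: dist_real_def)
        then show "convex {x. \<bar>x - x0\<bar> < e}" by simp
      qed (use h v e der bound in \<open>auto intro: DERIV_subset\<close>)
      then show ?thesis using h by (simp add: q_def abs_divide divide_simps)
    qed
    show "\<forall>\<^sub>F h in at 0. AE v in M. \<bar>q h v\<bar> \<le> g v"
      using ev ne
    proof eventually_elim
      case (elim h)
      then show ?case using *[of h] by auto
    qed
    show "AE v in M. ((\<lambda>h. q h v) \<longlongrightarrow> f' x0 v) (at 0)"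
    proof (rule AE_I2)
      fix v assume v: "v \<in> space M"
      have "((\<lambda>h. (f (x0 + h) v - f x0 v) / h) \<longlongrightarrow> f' x0 v) (at 0)"
        using der[of x0 v] v e by (simp add: DERIV_def)
      moreover have "\<forall>\<^sub>F h in at 0. (f (x0 + h) v - f x0 v) / h = q h v"
        using ev by eventually_elim (simp add: q_def)
      ultimately show "((\<lambda>h. q h v) \<longlongrightarrow> f' x0 v) (at 0)"
        by (rule Lim_transform_eventually)
    qed
  qed
  moreover have "\<forall>\<^sub>F h in at 0. integral\<^sup>L M (q h) = (integral\<^sup>L M (f (x0 + h)) - integral\<^sup>L M (f x0)) / h"
    using ev
  proof eventually_elim
    case (elim h)
    then show ?case using int[of "x0 + h"] int[of x0] e
      by (simp add: q_def)
  qed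
  ultimately show ?thesis
    unfolding DERIV_def by (rule Lim_transform_eventually)
qed

text \<open>
  For \<open>p > 0\<close> the constant comes from \<open>ln u \<le> u - 1\<close> at \<open>u = c * y / p\<close>. The lower end \<open>x > 0\<close> of
  the range takes care of negative exponents.
\<close>

lemma powr_le_exp:
  fixes c p x :: real
  assumes "c > 0" "x > 0"
  obtains K where "K > 0" "\<And>y. y \<ge> x \<Longrightarrow> y powr p \<le> K * exp (c * y)"
proof (cases "p > 0")
  case False
  show ?thesis
  proof
    fix y assume y: "y \<ge> x"
    have "y powr p \<le> x powr p * 1" using False assms y by (simp add: powr_mono2')
    also have "\<dots> \<le> x powr p * exp (c * y)"
      by (intro mult_left_mono) (use assms y in auto)
    finally show "y powr p \<le> x powr p * exp (c * y)" .
  qed (use assms in simp)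
next
  case True
  show ?thesis
  proof
    fix y assume y: "y \<ge> x"
    have "ln (c * y / p) \<le> c * y / p - 1"
      using assms y True by (intro ln_le_minus_one) auto
    moreover have "ln (c * y / p) = ln c + ln y - ln p" 
      using assms y True by (simp add: ln_mult ln_div)
    ultimately have "p * ln y \<le> p * (c * y / p - 1 + ln p - ln c)"
      using True by (intro mult_left_mono) auto
    also have "\<dots> \<le> c * y + p * (ln p - ln c)" using True by (simp add: field_simps)
    finally have "exp (p * ln y) \<le> exp (p * (ln p - ln c)) * exp (c * y)"
      by (simp add: exp_add[symmetric] add.commute)
    then show "y powr p \<le> (p / c) powr p * exp (c * y)"
      using assms y True by (simp add: powr_def ln_div)
  qed (use True assms in simp)
qed

lemma exp_powr_integrable:
  fixes c q :: real
  assumes "c > 0" "q > -1"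
  shows "set_integrable lborel {0<..} (\<lambda>v. exp (- c * v) * v powr q)"
proof -
  have "set_integrable lebesgue {0<..} (\<lambda>t. norm (complex_of_real t powr (complex_of_real (q+1) - 1) / of_real (exp (c * t))))"
    by (intro set_integrable_norm absolutely_integrable_Gamma_integral) (use assms in auto)
  also have "?this \<longleftrightarrow> set_integrable lebesgue {0<..} (\<lambda>v. exp (- c * v) * v powr q)"
    unfolding set_integrable_def
    by (intro arg_cong[where f = "integrable lebesgue"] ext)
       (auto simp: indicator_def norm_divide norm_powr_real_powr exp_minus field_simps)
  finally show ?thesis
    unfolding set_integrable_def by (subst (asm) integrable_completion) auto
qed

text \<open>
  For \<open>x > 0\<close> the factor \<open>(v + x) powr p\<close> is bounded by a multiple of \<open>exp (c / 2 * v)\<close>, which leaves a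
  gamma integral; for \<open>x = 0\<close> the two powers merge into \<open>v powr (p + q)\<close>.
\<close>

lemma shifted_gamma_integrand_integrable:
  fixes c p q x :: real
  assumes "c > 0" "q > -1" "x > 0 \<or> x = 0 \<and> p + q > -1"
  shows "set_integrable lborel {0<..} (\<lambda>v. exp (- c * v) * (v + x) powr p * v powr q)"
proof (cases "x > 0")
  case True
  obtain K where K: "K > 0" "\<And>y. y \<ge> x \<Longrightarrow> y powr p \<le> K * exp (c / 2 * y)"
    using powr_le_exp[of "c/2" x p] assms True by auto
  have "set_integrable lborel {0<..} (\<lambda>v. (K * exp (c / 2 * x)) * (exp (- (c/2) * v) * v powr q))"
    by (intro set_integrable_mult_right exp_powr_integrable) (use assms in auto)
  then show ?thesis
  proof (rule set_integrable_bound)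
    show "AE v in lborel. v \<in> {0<..} \<longrightarrow> norm (exp (- c * v) * (v + x) powr p * v powr q)
       \<le> norm ((K * exp (c / 2 * x)) * (exp (- (c/2) * v) * v powr q))"
    proof (intro AE_I2 impI)
      fix v :: real assume v: "v \<in> {0<..}"
      have "exp (- c * v) * (v + x) powr p * v powr q \<le> exp (- c * v) * (K * exp (c / 2 * (v + x))) * v powr q"
        by (intro mult_right_mono mult_left_mono K) (use v True in auto)
      also have "\<dots> = K * (exp (- c * v) * exp (c / 2 * (v + x))) * v powr q"
        by (simp add: mult_ac)
      also have "exp (- c * v) * exp (c / 2 * (v + x)) = exp (c / 2 * x) * exp (- (c / 2) * v)"
        by (simp add: exp_add[symmetric] field_simps)
      also have "K * (exp (c / 2 * x) * exp (- (c / 2) * v)) * v powr q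
          = (K * exp (c / 2 * x)) * (exp (- (c/2) * v) * v powr q)"
        by (simp add: mult_ac)
      finally show "norm (exp (- c * v) * (v + x) powr p * v powr q)
       \<le> norm ((K * exp (c / 2 * x)) * (exp (- (c/2) * v) * v powr q))"
        using K(1) by simp
    qed
  qed (simp add: set_borel_measurable_def)
next
  case False
  then have "x = 0" "p + q > -1" using assms by auto
  then show ?thesis using exp_powr_integrable[of c "p + q"] assms
    by (simp add: powr_add mult.assoc)
qed

section \<open>The integral \<open>\<integral>\<^sub>0\<^sup>\<infinity> exp (-v) * (v + x) powr p * v powr q dv\<close>\<close>

text \<open>
  Up to a gamma factor this is Tricomi's function. The present form, unlike the usual one
  \<open>\<integral> exp (-x t) t powr (a-1) (1+t) powr (b-a-1) dt\<close>, still makes sense at \<open>x = 0\<close>.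
\<close>

definition shifted_gamma :: "real \<Rightarrow> real \<Rightarrow> real \<Rightarrow> real" where
  "shifted_gamma p q x = (LBINT v:{0<..}. exp (- v) * (v + x) powr p * v powr q)"

lemma shifted_gamma_integrable:
  fixes p q x :: real
  assumes "q > -1" "x > 0 \<or> x = 0 \<and> p + q > -1"
  shows "set_integrable lborel {0<..} (\<lambda>v. exp (- v) * (v + x) powr p * v powr q)"
  using shifted_gamma_integrand_integrable[of 1 q x p] assms by simp

lemma shifted_gamma_pos:
  assumes "q > -1" "x > 0 \<or> x = 0 \<and> p + q > -1"
  shows "shifted_gamma p q x > 0"
proof -
  let ?f = "\<lambda>v. indicator {0<..} v *\<^sub>R (exp (- v) * (v + x) powr p * v powr q)"
  have f: "integrable lborel ?f"
    using shifted_gamma_integrable[OF assms] by (simp add: set_integrable_def)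
  have nn: "AE v in lborel. 0 \<le> ?f v" by (simp add: indicator_def)
  have "integral\<^sup>L lborel ?f \<noteq> 0"
  proof
    assume "integral\<^sup>L lborel ?f = 0"
    then have "AE v in lborel. ?f v = 0"
      using integral_nonneg_eq_0_iff_AE[OF f nn] by simp
    then have "AE v in lborel. v \<notin> {0<..<1::real}"
      by eventually_elim (use assms in \<open>auto simp: indicator_def split: if_splits\<close>)
    then have "emeasure lborel {0<..<1::real} = 0"
      by (subst (asm) AE_iff_measurable[of "{0<..<1::real}"]) auto
    then show False by simp
  qed
  moreover have "integral\<^sup>L lborel ?f \<ge> 0" using nn by (rule integral_nonneg_AE)
  ultimately show ?thesis unfolding shifted_gamma_def set_lebesgue_integral_def by linarith
qed

text \<open>
  The factor \<open>v + x\<close> is split into its two summands.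
\<close>

lemma shifted_gamma_Suc:
  assumes "q > -1" "x > 0 \<or> x = 0 \<and> p + q > -1"
  shows "shifted_gamma (p + 1) q x = shifted_gamma p (q + 1) x + x * shifted_gamma p q x"
proof -
  have x: "x \<ge> 0" using assms by auto
  have "shifted_gamma (p + 1) q x = (LBINT v:{0<..}. exp (- v) * (v + x) powr p * v powr (q + 1)
            + x * (exp (- v) * (v + x) powr p * v powr q))"
    unfolding shifted_gamma_def
  proof (rule set_lebesgue_integral_cong)
    show "\<forall>v. v \<in> {0<..} \<longrightarrow> exp (- v) * (v + x) powr (p + 1) * v powr q
      = exp (- v) * (v + x) powr p * v powr (q + 1) + x * (exp (- v) * (v + x) powr p * v powr q)"
    proof safe
      fix v :: real assume "v > 0"
      then have "(v + x) powr (p + 1) = (v + x) * (v + x) powr p" "v powr (q + 1) = v * v powr q"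
        using x by (auto simp: powr_add)
      then show "exp (- v) * (v + x) powr (p + 1) * v powr q
        = exp (- v) * (v + x) powr p * v powr (q + 1) + x * (exp (- v) * (v + x) powr p * v powr q)"
        by (simp add: algebra_simps)
    qed
  qed simp
  also have "\<dots> = shifted_gamma p (q + 1) x + x * shifted_gamma p q x"
    unfolding shifted_gamma_def
    by (subst set_integral_add)
       (use assms shifted_gamma_integrable[of "q+1" x p] shifted_gamma_integrable[of q x p] in auto)
  finally show ?thesis .
qed

text \<open>
  The boundary terms of \<open>exp (-v) * (v + x) powr p * v powr q\<close> vanish: at infinity by the exponential,
  at \<open>0\<close> by the power \<open>v powr q\<close>, or \<open>v powr (p + q)\<close> if \<open>x = 0\<close>.
\<close>

lemma shifted_gamma_by_parts:
  assumes "q > 0" "x > 0 \<or> x = 0 \<and> p + q > 0"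
  shows "shifted_gamma p q x = p * shifted_gamma (p - 1) q x + q * shifted_gamma p (q - 1) x"
proof -
  have x: "x \<ge> 0" using assms by auto
  let ?F = "\<lambda>v. exp (- v) * (v + x) powr p * v powr q"
  let ?f = "\<lambda>v. p * (exp (- v) * (v + x) powr (p - 1) * v powr q)
        + q * (exp (- v) * (v + x) powr p * v powr (q - 1)) - ?F v"
  have int: "set_integrable lborel {0<..} (\<lambda>v. exp (- v) * (v + x) powr (p - 1) * v powr q)"
       "set_integrable lborel {0<..} (\<lambda>v. exp (- v) * (v + x) powr p * v powr (q - 1))"
       "set_integrable lborel {0<..} ?F"
    using assms by (auto intro!: shifted_gamma_integrable)
  have intf: "set_integrable lborel {0<..} ?f"
    by (intro set_integral_diff set_integral_add set_integrable_mult_right int)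
  have "(LBINT v=0..\<infinity>. ?f v) = 0 - 0"
  proof (rule interval_integral_FTC_integrable)
    fix v :: real assume v: "0 < ereal v"
    show "(?F has_vector_derivative ?f v) (at v)"
      unfolding has_real_derivative_iff_has_vector_derivative[symmetric]
      by (rule derivative_eq_intros refl | use v x in \<open>simp add: algebra_simps\<close>)+
    show "isCont ?f v" using v x by (intro continuous_intros) auto
  next
    show "set_integrable lborel (einterval 0 \<infinity>) ?f"
      using intf by (simp add: zero_ereal_def)
    show "((?F \<circ> real_of_ereal) \<longlongrightarrow> 0) (at_right 0)"
      unfolding zero_ereal_def ereal_tendsto_simps1
    proof (cases "x > 0")
      case True
      have "((\<lambda>v. exp (- v) * (v + x) powr p * v powr q) \<longlongrightarrow> exp (- 0) * (0 + x) powr p * 0 powr q) (at_right 0)"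
        by (intro tendsto_intros tendsto_powr')
           (use True assms in \<open>auto simp: eventually_at_filter\<close>)
      then show "(?F \<longlongrightarrow> 0) (at_right 0)" by simp
    next
      case False
      then have x0: "x = 0" "p + q > 0" using assms by auto
      have "((\<lambda>v. exp (- v) * v powr (p + q)) \<longlongrightarrow> exp (- 0) * 0 powr (p + q)) (at_right 0)"
        by (intro tendsto_intros tendsto_powr')
           (use x0 in \<open>auto simp: eventually_at_filter\<close>)
      then show "(?F \<longlongrightarrow> 0) (at_right 0)" using x0 by (simp add: powr_add mult.assoc)
    qed
    obtain K1 where K1: "K1 > 0" "\<And>y. y \<ge> 1 \<Longrightarrow> y powr p \<le> K1 * exp (1/4 * y)"
      using powr_le_exp[of "1/4" 1 p] by auto
    obtain K2 where K2: "K2 > 0" "\<And>y. y \<ge> 1 \<Longrightarrow> y powr q \<le> K2 * exp (1/4 * y)"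
      using powr_le_exp[of "1/4" 1 q] by auto
    show "((?F \<circ> real_of_ereal) \<longlongrightarrow> 0) (at_left \<infinity>)"
      unfolding ereal_tendsto_simps1
    proof (rule tendsto_sandwich[of "\<lambda>_. 0"])
      show "\<forall>\<^sub>F v in at_top. ?F v \<le> exp (- v) * (K1 * exp (1/4 * (v + x))) * (K2 * exp (1/4 * v))"
        using eventually_ge_at_top[of 1]
      proof eventually_elim
        case (elim v)
        then show ?case using x K1(1) K2(1) by (intro mult_mono K1(2) K2(2)) auto
      qed
      show "((\<lambda>v. exp (- v) * (K1 * exp (1/4 * (v + x))) * (K2 * exp (1/4 * v))) \<longlongrightarrow> 0) at_top"
        using K1(1) K2(1) by real_asymp
    qed (auto intro: tendsto_const)
  qed simp
  then have "0 = (LBINT v:{0<..}. ?f v)"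
    by (simp add: interval_integral_to_infinity_eq zero_ereal_def)
  also have "\<dots> = p * shifted_gamma (p - 1) q x + q * shifted_gamma p (q - 1) x - shifted_gamma p q x"
    unfolding shifted_gamma_def using int by (simp add: set_integral_diff set_integral_add)
  finally show ?thesis by simp
qed

text \<open>
  On \<open>(x/2, 3x/2)\<close> the derivatives of the integrand are dominated by a multiple of
  \<open>exp (-v/2) * v powr q\<close>.
\<close>

lemma shifted_gamma_has_derivative:
  assumes "q > -1" "x > 0"
  shows "(shifted_gamma p q has_real_derivative p * shifted_gamma (p - 1) q x) (at x)"
proof -
  obtain K where K: "K > 0" "\<And>y. y \<ge> x/2 \<Longrightarrow> y powr (p - 1) \<le> K * exp (1/2 * y)"
    using powr_le_exp[of "1/2" "x/2" "p - 1"] assms by auto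
  have "((\<lambda>x. \<integral>v. indicator {0<..} v *\<^sub>R (exp (- v) * (v + x) powr p * v powr q) \<partial>lborel)
     has_real_derivative
     (\<integral>v. indicator {0<..} v *\<^sub>R (p * (exp (- v) * (v + x) powr (p - 1) * v powr q)) \<partial>lborel)) (at x)"
  proof (rule has_real_derivative_integral[where e = "x / 2"])
    fix y :: real assume "\<bar>y - x\<bar> < x / 2"
    then have y: "y \<ge> x / 2" "y > 0" "y \<le> 3 / 2 * x" unfolding abs_less_iff by linarith+
    show "integrable lborel (\<lambda>v. indicator {0<..} v *\<^sub>R (exp (- v) * (v + y) powr p * v powr q))"
      using shifted_gamma_integrable[of q y p] y assms by (simp add: set_integrable_def)
    fix v :: real
    show "((\<lambda>x. indicator {0<..} v *\<^sub>R (exp (- v) * (v + x) powr p * v powr q)) has_real_derivative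
        indicator {0<..} v *\<^sub>R (p * (exp (- v) * (v + y) powr (p - 1) * v powr q))) (at y)"
    proof (cases "v > 0")
      case True
      then show ?thesis using y
        by (auto intro!: derivative_eq_intros)
    qed simp
    show "\<bar>indicator {0<..} v *\<^sub>R (p * (exp (- v) * (v + y) powr (p - 1) * v powr q))\<bar>
      \<le> indicator {0<..} v *\<^sub>R ((\<bar>p\<bar> * K * exp (3/4 * x)) * (exp (- (1/2) * v) * v powr q))"
    proof (cases "v > 0")
      case True
      have "\<bar>p * (exp (- v) * (v + y) powr (p - 1) * v powr q)\<bar> =
             \<bar>p\<bar> * (exp (- v) * (v + y) powr (p - 1) * v powr q)" by (simp add: abs_mult)
      also have "\<dots> \<le> \<bar>p\<bar> * (exp (- v) * (K * exp (1/2 * (v + y))) * v powr q)"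
        by (intro mult_left_mono mult_right_mono K) (use y True in auto)
      also have "\<dots> \<le> \<bar>p\<bar> * (exp (- v) * (K * exp (1/2 * (v + 3/2 * x))) * v powr q)"
        by (intro mult_left_mono mult_right_mono) (use y True K(1) in auto)
      also have "\<dots> = \<bar>p\<bar> * K * (exp (- v) * exp (1/2 * (v + 3/2 * x))) * v powr q"
        by (simp add: mult_ac)
      also have "exp (- v) * exp (1/2 * (v + 3/2 * x)) = exp (3/4 * x) * exp (- (1/2) * v)"
        by (simp add: exp_add[symmetric] field_simps)
      finally show ?thesis using True by (simp add: mult_ac)
    qed simp
  next
    show "integrable lborel (\<lambda>v. indicator {0<..} v *\<^sub>R ((\<bar>p\<bar> * K * exp (3/4 * x)) * (exp (- (1/2) * v) * v powr q)))"
      using exp_powr_integrable[of "1/2" q] assms unfolding set_integrable_def[symmetric]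
      by (intro set_integrable_mult_right) auto
  qed (use assms in auto)
  then show ?thesis
    unfolding shifted_gamma_def set_lebesgue_integral_def by (simp add: fun_eq_iff mult_ac)
qed

text \<open>
  Since \<open>y powr p\<close> is monotone in \<open>y\<close>, its values between \<open>v\<close> and \<open>v + 1\<close> are at most the sum of the
  values at the two ends, whatever the sign of \<open>p\<close>; this yields the dominating function.
\<close>

lemma shifted_gamma_tendsto_at_0:
  assumes "q > -1" "p + q > -1"
  shows "(shifted_gamma p q \<longlongrightarrow> shifted_gamma p q 0) (at_right 0)"
  unfolding shifted_gamma_def set_lebesgue_integral_def
proof (rule dominated_convergence_at_within)
  let ?w = "\<lambda>v. indicator {0<..} v *\<^sub>R (exp (- v) * (v + 0) powr p * v powr q)
       + indicator {0<..} v *\<^sub>R (exp (- v) * (v + 1) powr p * v powr q)"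
  show "integrable lborel ?w"
    using shifted_gamma_integrable[of q 0 p] shifted_gamma_integrable[of q 1 p] assms
    unfolding set_integrable_def by (intro Bochner_Integration.integrable_add) auto
  have "\<forall>\<^sub>F t in at_right 0. 0 < t \<and> t < (1::real)"
    by (auto simp: eventually_at_right[of 0 1] intro!: exI[of _ 1])
  then show "\<forall>\<^sub>F t in at_right 0. AE v in lborel.
       \<bar>indicator {0<..} v *\<^sub>R (exp (- v) * (v + t) powr p * v powr q)\<bar> \<le> ?w v"
  proof eventually_elim
    case (elim t)
    show ?case
    proof (rule AE_I2)
      fix v :: real
      show "\<bar>indicator {0<..} v *\<^sub>R (exp (- v) * (v + t) powr p * v powr q)\<bar> \<le> ?w v"
      proof (cases "v > 0")
        case True
        have "(v + t) powr p \<le> (v + 0) powr p + (v + 1) powr p"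
        proof (cases "p \<ge> 0")
          case p: True
          then have "(v + t) powr p \<le> (v + 1) powr p" using True elim by (intro powr_mono2) auto
          then show ?thesis by (simp add: add_increasing)
        next
          case False
          then have "(v + t) powr p \<le> (v + 0) powr p" using True elim by (intro powr_mono2') auto
          then show ?thesis by (simp add: add_increasing2)
        qed
        then have "(exp (- v) * v powr q) * (v + t) powr p \<le> (exp (- v) * v powr q) * ((v + 0) powr p + (v + 1) powr p)"
          by (intro mult_left_mono) auto
        then show ?thesis using True by (simp add: algebra_simps)
      qed simp
    qed
  qed
  show "AE v in lborel. ((\<lambda>t. indicator {0<..} v *\<^sub>R (exp (- v) * (v + t) powr p * v powr q)) \<longlongrightarrow>
             indicator {0<..} v *\<^sub>R (exp (- v) * (v + 0) powr p * v powr q)) (at_right 0)"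
  proof (rule AE_I2)
    fix v :: real
    show "((\<lambda>t. indicator {0<..} v *\<^sub>R (exp (- v) * (v + t) powr p * v powr q)) \<longlongrightarrow>
             indicator {0<..} v *\<^sub>R (exp (- v) * (v + 0) powr p * v powr q)) (at_right 0)"
      by (cases "v > 0") (auto intro!: tendsto_eq_intros)
  qed
qed auto

text \<open>
  After division by \<open>x powr p\<close> the integrand contains \<open>(1 + v/x) powr p\<close>, which tends to \<open>1\<close> and leaves
  the gamma integral.
\<close>

lemma shifted_gamma_asymp:
  assumes "q > -1"
  shows "shifted_gamma p q \<sim>[at_top] (\<lambda>x. Gamma (q + 1) * x powr p)"
proof -
  define P where "P = max p 0"
  let ?s = "\<lambda>x v. indicator {0<..} v *\<^sub>R (exp (- v) * (1 + v / x) powr p * v powr q) :: real"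
  have "((\<lambda>x. \<integral>v. ?s x v \<partial>lborel) \<longlongrightarrow> (\<integral>v. indicator {0<..} v *\<^sub>R (exp (- v) * 1 * v powr q) \<partial>lborel)) at_top"
  proof (rule integral_dominated_convergence_at_top)
    show "integrable lborel (\<lambda>v. indicator {0<..} v *\<^sub>R (exp (- v) * (v + 1) powr P * v powr q))"
      using shifted_gamma_integrable[of q 1 P] assms unfolding set_integrable_def by simp
    show "\<forall>\<^sub>F x in at_top. AE v in lborel. norm (?s x v) \<le> indicator {0<..} v *\<^sub>R (exp (- v) * (v + 1) powr P * v powr q)"
      using eventually_ge_at_top[of 1]
    proof eventually_elim
      case (elim x)
      show ?case
      proof (rule AE_I2)
        fix v :: real
        show "norm (?s x v) \<le> indicator {0<..} v *\<^sub>R (exp (- v) * (v + 1) powr P * v powr q)"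
        proof (cases "v > 0")
          case True
          have "(1 + v / x) powr p \<le> (1 + v / x) powr P"
            unfolding P_def using True elim by (intro powr_mono) auto
          also have "\<dots> \<le> (v + 1) powr P"
            using True elim by (intro powr_mono2) (auto simp: P_def field_simps)
          finally have "(exp (- v) * v powr q) * (1 + v / x) powr p \<le> (exp (- v) * v powr q) * (v + 1) powr P"
            by (intro mult_left_mono) auto
          then show ?thesis using True by (simp add: mult_ac)
        qed simp
      qed
    qed
    show "AE v in lborel. ((\<lambda>x. ?s x v) \<longlongrightarrow> indicator {0<..} v *\<^sub>R (exp (- v) * 1 * v powr q)) at_top"
    proof (rule AE_I2)
      fix v :: real
      have "((\<lambda>x. v / x) \<longlongrightarrow> 0) at_top" by real_asymp
      then have "((\<lambda>x. (1 + v / x) powr p) \<longlongrightarrow> (1 + 0) powr p) at_top"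
        by (intro tendsto_intros) auto
      from tendsto_mult[OF tendsto_mult[OF tendsto_const[of "exp (- v)"] this] tendsto_const[of "v powr q"]]
      show "((\<lambda>x. ?s x v) \<longlongrightarrow> indicator {0<..} v *\<^sub>R (exp (- v) * 1 * v powr q)) at_top"
        by (cases "v > 0") simp_all
    qed
  qed auto
  moreover have "(\<integral>v. indicator {0<..} v *\<^sub>R (exp (- v) * 1 * v powr q) \<partial>lborel) = Gamma (q + 1)"
  proof -
    have "set_integrable lborel {0<..} (\<lambda>v. exp (- v) * v powr q)"
      using exp_powr_integrable[of 1 q] assms by simp
    from set_borel_integral_eq_integral(2)[OF this]
    have "(LBINT v:{0<..}. exp (- v) * v powr q) = integral {0<..} (\<lambda>v. exp (- v) * v powr q)" .
    also have "\<dots> = integral {0..} (\<lambda>v. exp (- v) * v powr q)"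
      by (rule integral_spike_set) (rule negligible_subset[of "{0}"]; force)+
    also have "\<dots> = integral {0..} (\<lambda>v. v powr (q + 1 - 1) / exp v)"
      by (simp add: exp_minus divide_inverse mult.commute)
    also have "\<dots> = Gamma (q + 1)"
      using Gamma_integral_real[of "q + 1"] assms by (intro integral_unique) auto
    finally show ?thesis unfolding set_lebesgue_integral_def by simp
  qed
  ultimately have "((\<lambda>x. \<integral>v. ?s x v \<partial>lborel) \<longlongrightarrow> Gamma (q + 1)) at_top" by simp
  moreover have "Gamma (q + 1) \<noteq> 0" using Gamma_real_pos[of "q + 1"] assms by linarith
  ultimately have "(\<lambda>x. \<integral>v. ?s x v \<partial>lborel) \<sim>[at_top] (\<lambda>_. Gamma (q + 1))"
    by (rule tendsto_imp_asymp_equiv_const)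
  then have "(\<lambda>x. (\<integral>v. ?s x v \<partial>lborel) * x powr p) \<sim>[at_top] (\<lambda>x. Gamma (q + 1) * x powr p)"
    by (intro asymp_equiv_intros)
  moreover have "\<forall>\<^sub>F x in at_top. (\<integral>v. ?s x v \<partial>lborel) * x powr p = shifted_gamma p q x"
    using eventually_gt_at_top[of 0]
  proof eventually_elim
    case (elim x)
    have eq: "?s x v * x powr p = indicator {0<..} v *\<^sub>R (exp (- v) * (v + x) powr p * v powr q)" for v
    proof (cases "v > 0")
      case True
      have "(1 + v / x) powr p * x powr p = ((1 + v / x) * x) powr p"
        using True elim by (subst powr_mult) auto
      also have "(1 + v / x) * x = v + x" using elim by (simp add: field_simps)
      finally show ?thesis using True by (simp add: mult_ac)
    qed simp
    then show ?case
      unfolding shifted_gamma_def set_lebesgue_integral_def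
      by (subst integral_mult_left_zero[symmetric]) (simp only: eq)
  qed
  ultimately show ?thesis by (rule asymp_equiv_transfer) simp_all
qed

section \<open>Kummer's equation and Tricomi's function\<close>

lemma kummer_solution_cmult:
  assumes "kummer_solution a b w"
  shows "kummer_solution a b (\<lambda>x. c * w x)"
proof -
  from assms obtain w' w'' where w: "\<And>x. x > 0 \<Longrightarrow> (w has_real_derivative w' x) (at x) \<and>
      (w' has_real_derivative w'' x) (at x) \<and> x * w'' x + (b - x) * w' x - a * w x = 0"
    unfolding kummer_solution_def by blast
  have "x * (c * w'' x) + (b - x) * (c * w' x) - a * (c * w x) = 0" if "x > 0" for x
  proof -
    have "x * (c * w'' x) + (b - x) * (c * w' x) - a * (c * w x)
        = c * (x * w'' x + (b - x) * w' x - a * w x)" by (simp add: algebra_simps)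
    then show ?thesis using w[OF that] by simp
  qed
  then show ?thesis unfolding kummer_solution_def
    using w by (intro exI[of _ "\<lambda>x. c * w' x"] exI[of _ "\<lambda>x. c * w'' x"]) (auto intro: DERIV_cmult)
qed

text \<open>
  The derivatives only change the exponent \<open>\<alpha> - 1\<close> to \<open>\<alpha> - 2\<close> and \<open>\<alpha> - 3\<close>, and the three integrals are
  linearly related by \<open>shifted_gamma_by_parts\<close> and \<open>shifted_gamma_Suc\<close>.
\<close>

lemma kummer_solution_shifted_gamma:
  assumes "\<beta> > 0"
  shows "kummer_solution (1 - \<alpha>) (2 - \<alpha> - \<beta>) (shifted_gamma (\<alpha> - 1) (\<beta> - 1))"
  unfolding kummer_solution_def
proof (intro exI allI impI conjI)
  fix x :: real assume x: "x > 0"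
  let ?J = "\<lambda>n. shifted_gamma (\<alpha> - n) (\<beta> - 1) x"
  show "(shifted_gamma (\<alpha> - 1) (\<beta> - 1) has_real_derivative
       (\<alpha> - 1) * shifted_gamma (\<alpha> - 2) (\<beta> - 1) x) (at x)"
    using shifted_gamma_has_derivative[of "\<beta> - 1" x "\<alpha> - 1"] x assms by simp
  show "((\<lambda>x. (\<alpha> - 1) * shifted_gamma (\<alpha> - 2) (\<beta> - 1) x) has_real_derivative
       (\<alpha> - 1) * ((\<alpha> - 2) * shifted_gamma (\<alpha> - 3) (\<beta> - 1) x)) (at x)"
    using shifted_gamma_has_derivative[of "\<beta> - 1" x "\<alpha> - 2"] x assms by (intro DERIV_cmult) simp
  have 1: "shifted_gamma (\<alpha> - 2) \<beta> x = (\<alpha> - 2) * shifted_gamma (\<alpha> - 3) \<beta> x + \<beta> * ?J 2"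
    using shifted_gamma_by_parts[of \<beta> x "\<alpha> - 2"] x assms by simp
  have 2: "?J 1 = shifted_gamma (\<alpha> - 2) \<beta> x + x * ?J 2"
    using shifted_gamma_Suc[of "\<beta> - 1" x "\<alpha> - 2"] x assms by simp
  have 3: "?J 2 = shifted_gamma (\<alpha> - 3) \<beta> x + x * ?J 3"
    using shifted_gamma_Suc[of "\<beta> - 1" x "\<alpha> - 3"] x assms by simp
  have "x * ((\<alpha> - 1) * ((\<alpha> - 2) * ?J 3)) + (2 - \<alpha> - \<beta> - x) * ((\<alpha> - 1) * ?J 2) - (1 - \<alpha>) * ?J 1
     = (\<alpha> - 1) * (?J 1 - x * ?J 2 - (\<alpha> - 2) * (?J 2 - x * ?J 3) - \<beta> * ?J 2)"
    by (simp add: algebra_simps)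
  also have "?J 2 - x * ?J 3 = shifted_gamma (\<alpha> - 3) \<beta> x" using 3 by simp
  also have "?J 1 - x * ?J 2 = shifted_gamma (\<alpha> - 2) \<beta> x" using 2 by simp
  also have "(\<alpha> - 1) * (shifted_gamma (\<alpha> - 2) \<beta> x - (\<alpha> - 2) * shifted_gamma (\<alpha> - 3) \<beta> x - \<beta> * ?J 2) = 0"
    using 1 by simp
  finally show "x * ((\<alpha> - 1) * ((\<alpha> - 2) * ?J 3)) + (2 - \<alpha> - \<beta> - x) * ((\<alpha> - 1) * ?J 2) - (1 - \<alpha>) * ?J 1 = 0" .
qed

text \<open>
  By Abel's identity the Wronskian of the two solutions is \<open>C * exp x * x powr (-b)\<close>, so that the
  quotient \<open>q = w / W\<close> has the derivative \<open>C * exp x * x powr (-b) / W\<^sup>2\<close>. If \<open>C \<noteq> 0\<close>, this grows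
  exponentially in absolute value, although \<open>q\<close> tends to \<open>1\<close>. Hence \<open>C = 0\<close> and \<open>q\<close> is
  constantly \<open>1\<close>.
\<close>

lemma kummer_solution_unique:
  assumes w: "kummer_solution a b w" "w \<sim>[at_top] (\<lambda>t. t powr (- a))"
    and W: "kummer_solution a b W" "W \<sim>[at_top] (\<lambda>t. t powr (- a))" "\<And>x. x > 0 \<Longrightarrow> W x > 0"
    and x: "x > 0"
  shows "w x = W x"
proof -
  from w(1) obtain w' w'' where w': "\<And>x. x > 0 \<Longrightarrow> (w has_real_derivative w' x) (at x)"
      "\<And>x. x > 0 \<Longrightarrow> (w' has_real_derivative w'' x) (at x)"
      "\<And>x. x > 0 \<Longrightarrow> x * w'' x + (b - x) * w' x - a * w x = 0"
    unfolding kummer_solution_def by blast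
  from W(1) obtain W' W'' where W': "\<And>x. x > 0 \<Longrightarrow> (W has_real_derivative W' x) (at x)"
      "\<And>x. x > 0 \<Longrightarrow> (W' has_real_derivative W'' x) (at x)"
      "\<And>x. x > 0 \<Longrightarrow> x * W'' x + (b - x) * W' x - a * W x = 0"
    unfolding kummer_solution_def by blast
  define N where "N = (\<lambda>x. w' x * W x - w x * W' x)"
  define N' where "N' = (\<lambda>x. w'' x * W x - w x * W'' x)"
  have N': "(N has_real_derivative N' x) (at x)" if "x > 0" for x
    unfolding N_def N'_def
    by (rule derivative_eq_intros w' W' refl that)+ simp
  have abel: "x * N' x = (x - b) * N x" if "x > 0" for x
  proof -
    have "x * N' x - (x - b) * N x =
      (x * w'' x + (b - x) * w' x - a * w x) * W x - w x * (x * W'' x + (b - x) * W' x - a * W x)"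
      by (simp add: N_def N'_def algebra_simps)
    then show ?thesis using w'(3) W'(3) that by simp
  qed
  have "\<exists>C. \<forall>x\<in>{0<..}. N x * exp (- x) * x powr b = C"
  proof (rule has_field_derivative_zero_constant)
    fix x :: real assume "x \<in> {0<..}"
    then have x: "x > 0" by simp
    have "((\<lambda>x. N x * exp (- x) * x powr b) has_real_derivative
       (N' x * exp (- x) - N x * exp (- x)) * x powr b + N x * exp (- x) * (b * x powr (b - 1))) (at x)"
      by (rule derivative_eq_intros N' refl x)+ (use x in \<open>simp add: algebra_simps\<close>)
    also have "(N' x * exp (- x) - N x * exp (- x)) * x powr b + N x * exp (- x) * (b * x powr (b - 1))
      = exp (- x) * x powr (b - 1) * (x * N' x - (x - b) * N x)"
    proof -
      have "x powr b = x * x powr (b - 1)" using x by (simp add: powr_mult_base)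
      then show ?thesis by (simp add: algebra_simps)
    qed
    also have "\<dots> = 0" using abel[OF x] by simp
    finally show "((\<lambda>x. N x * exp (- x) * x powr b) has_real_derivative 0) (at x within {0<..})"
      by (rule DERIV_subset) simp
  qed simp
  then obtain C where C: "\<And>x. x > 0 \<Longrightarrow> N x * exp (- x) * x powr b = C" by auto
  have N: "N x = C * (exp x * x powr (- b))" if "x > 0" for x
    using C[OF that] that by (simp add: exp_minus powr_minus field_simps)
  define q where "q = (\<lambda>x. w x / W x)"
  have q': "(q has_real_derivative C * (exp x * x powr (- b) / (W x)\<^sup>2)) (at x)" if "x > 0" for x
  proof -
    have "(q has_real_derivative N x / (W x)\<^sup>2) (at x)"
      unfolding q_def N_def using W(3)[OF that]
      by (auto intro!: derivative_eq_intros w' W' that simp: power2_eq_square)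
    then show ?thesis using N[OF that] by simp
  qed
  have qlim: "(q \<longlongrightarrow> 1) at_top"
  proof -
    have "w \<sim>[at_top] W" using w(2) W(2) by (meson asymp_equiv_sym asymp_equiv_trans)
    moreover have "\<forall>\<^sub>F x in at_top. w x \<noteq> 0 \<or> W x \<noteq> 0"
      using eventually_gt_at_top[of 0] by (rule eventually_mono) (metis W(3) less_irrefl)
    ultimately have "((\<lambda>x. w x / W x) \<longlongrightarrow> 1) at_top" by (rule asymp_equivD_strong)
    then show ?thesis by (simp add: q_def)
  qed
  have "C = 0"
  proof (rule ccontr)
    assume C0: "C \<noteq> 0"
    have "\<forall>\<^sub>F t in at_top. W t \<noteq> 0 \<or> t powr (- a) \<noteq> 0"
      using eventually_gt_at_top[of 0] by (rule eventually_mono) (metis W(3) less_irrefl)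
    from asymp_equivD_strong[OF W(2) this]
    have "((\<lambda>t. W t / t powr (- a)) \<longlongrightarrow> 1) at_top" .
    then have "\<forall>\<^sub>F t in at_top. W t / t powr (- a) < 2" by (rule order_tendstoD) simp
    moreover have "\<forall>\<^sub>F t in at_top. exp t * t powr (- b) / (2 * t powr (- a))\<^sup>2 \<ge> 1"
    proof -
      have "filterlim (\<lambda>t. exp t * t powr (- b) / (2 * t powr (- a))\<^sup>2) at_top at_top" by real_asymp
      then show ?thesis by (simp add: filterlim_at_top)
    qed
    ultimately have "\<forall>\<^sub>F t in at_top. t > 0 \<and> exp t * t powr (- b) / (W t)\<^sup>2 \<ge> 1"
      using eventually_gt_at_top[of 0]
    proof eventually_elim
      case (elim t)
      then have "W t \<le> 2 * t powr (- a)" "W t > 0" using W(3) by (auto simp: field_simps)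
      then have "(W t)\<^sup>2 \<le> (2 * t powr (- a))\<^sup>2" by (intro power_mono) auto
      then have "exp t * t powr (- b) / (2 * t powr (- a))\<^sup>2 \<le> exp t * t powr (- b) / (W t)\<^sup>2"
        using \<open>W t > 0\<close> elim by (intro divide_left_mono) (auto intro!: mult_pos_pos)
      then show ?case using elim by linarith
    qed
    then obtain X where X: "\<And>t. t \<ge> X \<Longrightarrow> t > 0" "\<And>t. t \<ge> X \<Longrightarrow> exp t * t powr (- b) / (W t)\<^sup>2 \<ge> 1"
      by (auto simp: eventually_at_top_linorder)
    \<comment> \<open>Dividing by \<open>C\<close> removes its sign.\<close>
    have "q X / C - X \<le> q t / C - t" if t: "t \<ge> X" for t
    proof (rule DERIV_nonneg_imp_nondecreasing[OF t])
      fix u assume u: "X \<le> u" "u \<le> t"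
      have "((\<lambda>t. q t / C - t) has_real_derivative exp u * u powr (- b) / (W u)\<^sup>2 - 1) (at u)"
        using DERIV_diff[OF DERIV_cdivide[OF q'[OF X(1)[OF u(1)]], of C] DERIV_ident] C0 by simp
      then show "\<exists>y. ((\<lambda>t. q t / C - t) has_real_derivative y) (at u) \<and> 0 \<le> y"
        using X(2)[OF u(1)] by force
    qed
    then have "\<forall>\<^sub>F t in at_top. q X / C - X + t \<le> q t / C"
      by (intro eventually_at_top_linorderI[of X]) (simp add: algebra_simps)
    moreover have "filterlim (\<lambda>t. q X / C - X + t) at_top at_top" by real_asymp
    ultimately have "filterlim (\<lambda>t. q t / C) at_top at_top"
      by (rule filterlim_at_top_mono[rotated])
    moreover have "((\<lambda>t. q t / C) \<longlongrightarrow> 1 / C) at_top"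
      using qlim C0 by (intro tendsto_intros)
    ultimately show False
      using not_tendsto_and_filterlim_at_infinity[of "at_top :: real filter" "\<lambda>t. q t / C" "1 / C"]
      by (auto intro: filterlim_at_top_imp_at_infinity)
  qed
  have "\<exists>D. \<forall>x\<in>{0<..}. q x = D"
  proof (rule has_field_derivative_zero_constant)
    fix x :: real assume "x \<in> {0<..}"
    then show "(q has_real_derivative 0) (at x within {0<..})"
      using q'[of x] \<open>C = 0\<close> by (auto intro: DERIV_subset)
  qed simp
  then obtain D where D: "\<And>x. x > 0 \<Longrightarrow> q x = D" by auto
  have "\<forall>\<^sub>F x in at_top. q x = D"
    by (rule eventually_mono[OF eventually_gt_at_top[of 0]]) (rule D)
  then have "(q \<longlongrightarrow> D) at_top" by (rule tendsto_eventually)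
  with qlim have "D = 1" by (intro tendsto_unique) auto
  with D[OF x] W(3)[OF x] show ?thesis by (simp add: q_def)
qed

lemma normalised_shifted_gamma_asymp:
  assumes "\<beta> > 0"
  shows "(\<lambda>x. 1 / Gamma \<beta> * shifted_gamma (\<alpha> - 1) (\<beta> - 1) x) \<sim>[at_top] (\<lambda>x. x powr (- (1 - \<alpha>)))"
proof -
  have "(\<lambda>x. 1 / Gamma \<beta> * shifted_gamma (\<alpha> - 1) (\<beta> - 1) x) \<sim>[at_top]
      (\<lambda>x. 1 / Gamma \<beta> * (Gamma (\<beta> - 1 + 1) * x powr (\<alpha> - 1)))"
    by (intro asymp_equiv_mult asymp_equiv_refl shifted_gamma_asymp) (use assms in simp)
  moreover have "Gamma \<beta> \<noteq> 0" using Gamma_real_pos[of \<beta>] assms by linarith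
  ultimately show ?thesis by simp
qed

lemma tricomi_U_eq_kummer_solution:
  assumes "kummer_solution a b W" "W \<sim>[at_top] (\<lambda>t. t powr (- a))" "\<And>x. x > 0 \<Longrightarrow> W x > 0"
    and "x > 0"
  shows "tricomi_U a b x = W x"
  unfolding tricomi_U_def
proof (rule the_equality)
  show "\<exists>w. kummer_solution a b w \<and> w \<sim>[at_top] (\<lambda>t. t powr (- a)) \<and> W x = w x"
    using assms by blast
  show "y = W x" if "\<exists>w. kummer_solution a b w \<and> w \<sim>[at_top] (\<lambda>t. t powr (- a)) \<and> y = w x" for y
    using that kummer_solution_unique[OF _ _ assms] by blast
qed

lemma tricomi_U_eq_shifted_gamma:
  assumes "\<beta> > 0" "x > 0"
  shows "tricomi_U (1 - \<alpha>) (2 - \<alpha> - \<beta>) x = shifted_gamma (\<alpha> - 1) (\<beta> - 1) x / Gamma \<beta>"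
proof -
  have "tricomi_U (1 - \<alpha>) (2 - \<alpha> - \<beta>) x = 1 / Gamma \<beta> * shifted_gamma (\<alpha> - 1) (\<beta> - 1) x"
    using assms
    by (intro tricomi_U_eq_kummer_solution kummer_solution_cmult kummer_solution_shifted_gamma
          normalised_shifted_gamma_asymp)
       (auto intro!: mult_pos_pos divide_pos_pos shifted_gamma_pos Gamma_real_pos)
  then show ?thesis by simp
qed

section \<open>The Bessel function \<open>K\<^sub>\<nu>\<close> as a solution of Kummer's equation\<close>

lemma cosh_ge_quadratic: "cosh t \<ge> 1 + t\<^sup>2 / 2" for t :: real
proof -
  have *: "\<bar>t / 2\<bar> \<le> \<bar>sinh (t / 2)\<bar>"
    using real_le_abs_sinh[of "t / 2"] by (simp add: sinh_field_def exp_minus)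
  have "cosh t = 2 * (sinh (t / 2))\<^sup>2 + 1"
    using cosh_double[of "t / 2"] by (simp add: cosh_square_eq)
  moreover have "(t / 2)\<^sup>2 \<le> (sinh (t / 2))\<^sup>2"
    using iffD1[OF abs_le_square_iff *] .
  ultimately show ?thesis by (simp add: power2_eq_square)
qed

lemma cosh_mult_le_exp:
  fixes \<nu> t :: real
  assumes "t \<ge> 0"
  shows "cosh (\<nu> * t) \<le> exp (\<bar>\<nu>\<bar> * t)"
proof -
  have "cosh (\<nu> * t) = cosh \<bar>\<nu> * t\<bar>" by simp
  also have "\<dots> = cosh (\<bar>\<nu>\<bar> * t)" using assms by (simp add: abs_mult)
  also have "\<dots> \<le> exp (\<bar>\<nu>\<bar> * t)"
  proof -
    have "exp (- (\<bar>\<nu>\<bar> * t)) \<le> exp (\<bar>\<nu>\<bar> * t)" using assms by simp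
    then show ?thesis by (simp add: cosh_field_def)
  qed
  finally show ?thesis .
qed

text \<open>
  The exponentials \<open>exp t\<close> and \<open>exp (\<bar>\<nu>\<bar> * t)\<close> are at most powers of \<open>2 * cosh t\<close>, and every power of
  \<open>cosh t\<close> is absorbed by \<open>exp (z * cosh t)\<close>. Monotonicity in \<open>y\<close> makes the bound uniform for \<open>y \<ge> z\<close>,
  as differentiation under the integral requires.
\<close>

lemma besselK_integrand_bound:
  fixes z \<nu> :: real
  assumes "z > 0"
  obtains K where "K > 0"
    "\<And>y t. y \<ge> z \<Longrightarrow> t \<ge> 0 \<Longrightarrow> exp (- y * cosh t) * cosh t ^ n * cosh (\<nu> * t) \<le> K * exp (- t)"
proof -
  obtain K where K: "K > 0" "\<And>y. y \<ge> 1 \<Longrightarrow> y powr (real n + \<bar>\<nu>\<bar> + 1) \<le> K * exp (z * y)"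
    using powr_le_exp[of z 1 "real n + \<bar>\<nu>\<bar> + 1"] assms by auto
  show ?thesis
  proof (rule that[of "K * 2 powr (\<bar>\<nu>\<bar> + 1)"])
    fix y t :: real assume y: "y \<ge> z" and t: "t \<ge> 0"
    have c: "cosh t > 0" "cosh t \<ge> 1" using cosh_real_pos cosh_real_ge_1 by auto
    have "exp t \<le> 2 * cosh t" by (simp add: cosh_field_def)
    then have "exp t powr (\<bar>\<nu>\<bar> + 1) \<le> (2 * cosh t) powr (\<bar>\<nu>\<bar> + 1)" by (intro powr_mono2) auto
    then have 1: "exp (\<bar>\<nu>\<bar> * t) * exp t \<le> 2 powr (\<bar>\<nu>\<bar> + 1) * cosh t powr (\<bar>\<nu>\<bar> + 1)"
      by (simp add: powr_def exp_add[symmetric] ring_distribs ln_mult)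
    have "exp (- y * cosh t) \<le> exp (- z * cosh t)" using y c by simp
    moreover have "cosh (\<nu> * t) \<le> exp (- t) * (exp (\<bar>\<nu>\<bar> * t) * exp t)"
    proof -
      have "exp (- t) * (exp (\<bar>\<nu>\<bar> * t) * exp t) = exp (\<bar>\<nu>\<bar> * t)"
        by (simp only: exp_add[symmetric]) simp
      then show ?thesis using cosh_mult_le_exp[OF t, of \<nu>] by linarith
    qed
    ultimately have "exp (- y * cosh t) * cosh t ^ n * cosh (\<nu> * t)
        \<le> exp (- z * cosh t) * cosh t ^ n * (exp (- t) * (exp (\<bar>\<nu>\<bar> * t) * exp t))"
      by (intro mult_mono) auto
    also have "\<dots> \<le> exp (- z * cosh t) * cosh t ^ n * (exp (- t) * (2 powr (\<bar>\<nu>\<bar> + 1) * cosh t powr (\<bar>\<nu>\<bar> + 1)))"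
      by (intro mult_left_mono 1) auto
    also have "\<dots> = exp (- z * cosh t) * 2 powr (\<bar>\<nu>\<bar> + 1) * exp (- t) * cosh t powr (real n + \<bar>\<nu>\<bar> + 1)"
      using c by (simp add: powr_add powr_realpow mult_ac)
    also have "\<dots> \<le> exp (- z * cosh t) * 2 powr (\<bar>\<nu>\<bar> + 1) * exp (- t) * (K * exp (z * cosh t))"
      by (intro mult_left_mono K c) auto
    also have "\<dots> = K * 2 powr (\<bar>\<nu>\<bar> + 1) * exp (- t) * (exp (- z * cosh t) * exp (z * cosh t))"
      by (simp add: mult_ac)
    also have "exp (- z * cosh t) * exp (z * cosh t) = 1" by (simp add: exp_add[symmetric])
    finally show "exp (- y * cosh t) * cosh t ^ n * cosh (\<nu> * t) \<le> K * 2 powr (\<bar>\<nu>\<bar> + 1) * exp (- t)"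
      by simp
  qed (use K in simp)
qed

lemma exp_minus_integrable: "set_integrable lborel {0<..} (\<lambda>t::real. exp (- t))"
  using exp_powr_integrable[of 1 0]
  by (rule set_integrable_cong[THEN iffD1, rotated -1]) auto

lemma besselK_integrand_integrable:
  fixes z \<nu> :: real
  assumes "z > 0"
  shows "set_integrable lborel {0<..} (\<lambda>t. exp (- z * cosh t) * cosh t ^ n * cosh (\<nu> * t))"
proof -
  obtain K where K: "K > 0"
      "\<And>y t. y \<ge> z \<Longrightarrow> t \<ge> 0 \<Longrightarrow> exp (- y * cosh t) * cosh t ^ n * cosh (\<nu> * t) \<le> K * exp (- t)"
    using besselK_integrand_bound[OF assms] by metis
  show ?thesis
  proof (rule set_integrable_bound)
    show "set_integrable lborel {0<..} (\<lambda>t::real. K * exp (- t))"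
      by (intro set_integrable_mult_right exp_minus_integrable)
    show "AE t in lborel. t \<in> {0<..} \<longrightarrow> norm (exp (- z * cosh t) * cosh t ^ n * cosh (\<nu> * t)) \<le> norm (K * exp (- t))"
      using K by (intro AE_I2 impI) simp
    show "set_borel_measurable lborel {0<..} (\<lambda>t. exp (- z * cosh t) * cosh t ^ n * cosh (\<nu> * t))"
    proof -
      have [measurable]: "(\<lambda>t. exp (- z * cosh t) * cosh t ^ n * cosh (\<nu> * t)) \<in> borel_measurable borel"
        by (intro borel_measurable_continuous_onI continuous_intros)
      show ?thesis unfolding set_borel_measurable_def by measurable
    qed
  qed
qed

text \<open>
  Up to the sign \<open>(-1)^n\<close> this is the \<open>n\<close>-th derivative of \<open>K\<^sub>\<nu>\<close> at \<open>z > 0\<close>.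
\<close>

definition besselK_moment :: "nat \<Rightarrow> real \<Rightarrow> real \<Rightarrow> real" where
  "besselK_moment n \<nu> z = (LBINT t:{0<..}. exp (- z * cosh t) * cosh t ^ n * cosh (\<nu> * t))"

lemma besselK_eq_moment: "besselK \<nu> z = besselK_moment 0 \<nu> z"
proof -
  have [measurable]: "(\<lambda>t. exp (- z * cosh t) * cosh (\<nu> * t)) \<in> borel_measurable borel"
    by (intro borel_measurable_continuous_onI continuous_intros)
  have "(\<integral>t. indicator {0..} t *\<^sub>R (exp (- z * cosh t) * cosh (\<nu> * t)) \<partial>lborel)
      = (\<integral>t. indicator {0<..} t *\<^sub>R (exp (- z * cosh t) * cosh (\<nu> * t)) \<partial>lborel)"
  proof (rule integral_cong_AE)
    show "AE t in lborel. indicator {0..} t *\<^sub>R (exp (- z * cosh t) * cosh (\<nu> * t))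
        = indicator {0<..} t *\<^sub>R (exp (- z * cosh t) * cosh (\<nu> * t))"
      using AE_lborel_singleton[of 0] by eventually_elim (auto simp: indicator_def)
  qed measurable
  then show ?thesis by (simp add: besselK_def besselK_moment_def set_lebesgue_integral_def)
qed

lemma besselK_moment_has_derivative:
  assumes "z > 0"
  shows "(besselK_moment n \<nu> has_real_derivative - besselK_moment (Suc n) \<nu> z) (at z)"
proof -
  obtain K where K: "K > 0"
      "\<And>y t. y \<ge> z / 2 \<Longrightarrow> t \<ge> 0 \<Longrightarrow> exp (- y * cosh t) * cosh t ^ Suc n * cosh (\<nu> * t) \<le> K * exp (- t)"
    using besselK_integrand_bound[of "z / 2" "Suc n" \<nu>] assms by auto
  have "((\<lambda>z. \<integral>t. indicator {0<..} t *\<^sub>R (exp (- z * cosh t) * cosh t ^ n * cosh (\<nu> * t)) \<partial>lborel)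
     has_real_derivative
     (\<integral>t. - (indicator {0<..} t *\<^sub>R (exp (- z * cosh t) * cosh t ^ Suc n * cosh (\<nu> * t))) \<partial>lborel)) (at z)"
  proof (rule has_real_derivative_integral[where e = "z / 2" and g = "\<lambda>t. indicator {0<..} t *\<^sub>R (K * exp (- t))"])
    fix y :: real assume "\<bar>y - z\<bar> < z / 2"
    then have y: "y \<ge> z / 2" "y > 0" unfolding abs_less_iff by linarith+
    show "integrable lborel (\<lambda>t. indicator {0<..} t *\<^sub>R (exp (- y * cosh t) * cosh t ^ n * cosh (\<nu> * t)))"
      using besselK_integrand_integrable[OF y(2)] by (simp add: set_integrable_def)
    fix t :: real
    show "((\<lambda>z. indicator {0<..} t *\<^sub>R (exp (- z * cosh t) * cosh t ^ n * cosh (\<nu> * t))) has_real_derivative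
        - (indicator {0<..} t *\<^sub>R (exp (- y * cosh t) * cosh t ^ Suc n * cosh (\<nu> * t)))) (at y)"
      by (cases "t > 0") (auto intro!: derivative_eq_intros)
    show "\<bar>- (indicator {0<..} t *\<^sub>R (exp (- y * cosh t) * cosh t ^ Suc n * cosh (\<nu> * t)))\<bar>
      \<le> indicator {0<..} t *\<^sub>R (K * exp (- t))"
      using K(2)[OF y(1), of t] by (auto simp: indicator_def abs_mult power_abs)
  next
    show "integrable lborel (\<lambda>t. indicator {0<..} t *\<^sub>R (K * exp (- t)) :: real)"
      unfolding set_integrable_def[symmetric]
      by (intro set_integrable_mult_right exp_minus_integrable)
    show "(\<lambda>t. - (indicator {0<..} t *\<^sub>R (exp (- z * cosh t) * cosh t ^ Suc n * cosh (\<nu> * t)))) \<in> borel_measurable lborel"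
      using besselK_integrand_integrable[OF assms, of "Suc n" \<nu>] 
      by (intro borel_measurable_uminus borel_measurable_integrable) (simp add: set_integrable_def)
  qed (use assms in auto)
  then show ?thesis
    unfolding besselK_moment_def set_lebesgue_integral_def by simp
qed

text \<open>
  This is the modified Bessel equation. Its left-hand side is the integral of the derivative of
  \<open>- z * sinh t * exp (-z * cosh t) * cosh (\<nu> * t) - \<nu> * exp (-z * cosh t) * sinh (\<nu> * t)\<close>, which vanishes
  at \<open>0\<close> and at infinity.
\<close>

lemma besselK_moment_ode:
  assumes "z > 0"
  shows "z\<^sup>2 * besselK_moment 2 \<nu> z - z * besselK_moment 1 \<nu> z - (z\<^sup>2 + \<nu>\<^sup>2) * besselK_moment 0 \<nu> z = 0"
proof -
  let ?h = "\<lambda>n t. exp (- z * cosh t) * cosh t ^ n * cosh (\<nu> * t)"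
  let ?G = "\<lambda>t. - z * sinh t * exp (- z * cosh t) * cosh (\<nu> * t) - \<nu> * exp (- z * cosh t) * sinh (\<nu> * t)"
  let ?g = "\<lambda>t. z\<^sup>2 * ?h 2 t - z * ?h 1 t - (z\<^sup>2 + \<nu>\<^sup>2) * ?h 0 t"
  note int = besselK_integrand_integrable[OF assms]
  have intg: "set_integrable lborel {0<..} ?g"
    by (intro set_integral_diff set_integrable_mult_right int)
  have "(LBINT t=0..\<infinity>. ?g t) = 0 - 0"
  proof (rule interval_integral_FTC_integrable)
    fix t :: real assume t: "0 < ereal t"
    show "(?G has_vector_derivative ?g t) (at t)"
      unfolding has_real_derivative_iff_has_vector_derivative[symmetric]
    proof -
      have "(?G has_real_derivative exp (- z * cosh t) * cosh (\<nu> * t) * (z\<^sup>2 * (sinh t)\<^sup>2 - z * cosh t - \<nu>\<^sup>2)) (at t)"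
        by (auto intro!: derivative_eq_intros simp: algebra_simps power2_eq_square)
      then show "(?G has_real_derivative ?g t) (at t)"
        by (rule DERIV_cong) (simp add: sinh_square_eq algebra_simps)
    qed
    show "isCont ?g t" by (intro continuous_intros)
  next
    show "set_integrable lborel (einterval 0 \<infinity>) ?g"
      using intg by (simp add: zero_ereal_def)
    have "isCont ?G 0" by (intro continuous_intros)
    then have "(?G \<longlongrightarrow> ?G 0) (at_right 0)"
      using continuous_at_imp_continuous_at_within continuous_within by blast
    then show "((?G \<circ> real_of_ereal) \<longlongrightarrow> 0) (at_right 0)"
      unfolding zero_ereal_def ereal_tendsto_simps1 by simp
    obtain K0 where K0: "K0 > 0" "\<And>y t. y \<ge> z \<Longrightarrow> t \<ge> 0 \<Longrightarrow> exp (- y * cosh t) * cosh t ^ 0 * cosh (\<nu> * t) \<le> K0 * exp (- t)"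
      using besselK_integrand_bound[of z 0 \<nu>] assms by metis
    obtain K1 where K1: "K1 > 0" "\<And>y t. y \<ge> z \<Longrightarrow> t \<ge> 0 \<Longrightarrow> exp (- y * cosh t) * cosh t ^ 1 * cosh (\<nu> * t) \<le> K1 * exp (- t)"
      using besselK_integrand_bound[of z 1 \<nu>] assms by metis
    have "(?G \<longlongrightarrow> 0) at_top"
    proof (rule Lim_null_comparison)
      show "\<forall>\<^sub>F t in at_top. norm (?G t) \<le> (z * K1 + \<bar>\<nu>\<bar> * K0) * exp (- t)"
        using eventually_ge_at_top[of 0]
      proof eventually_elim
        case (elim t)
        have s: "\<bar>sinh u\<bar> \<le> cosh u" for u :: real
          using sinh_le_cosh_real[of u] sinh_le_cosh_real[of "-u"] by (auto simp: abs_le_iff)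
        have "norm (?G t) \<le> \<bar>z * sinh t * exp (- z * cosh t) * cosh (\<nu> * t)\<bar> + \<bar>\<nu> * exp (- z * cosh t) * sinh (\<nu> * t)\<bar>"
          by (simp add: abs_triangle_ineq4)
        also have "\<dots> = z * (exp (- z * cosh t) * \<bar>sinh t\<bar> * cosh (\<nu> * t)) + \<bar>\<nu>\<bar> * (exp (- z * cosh t) * \<bar>sinh (\<nu> * t)\<bar>)"
          using assms by (simp add: abs_mult)
        also have "\<dots> \<le> z * (exp (- z * cosh t) * cosh t * cosh (\<nu> * t)) + \<bar>\<nu>\<bar> * (exp (- z * cosh t) * cosh (\<nu> * t))"
          using assms by (intro add_mono mult_left_mono mult_right_mono s) auto
        also have "\<dots> \<le> z * (K1 * exp (- t)) + \<bar>\<nu>\<bar> * (K0 * exp (- t))"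
          using assms K0(2)[of z t] K1(2)[of z t] elim by (intro add_mono mult_left_mono) auto
        finally show ?case by (simp add: algebra_simps)
      qed
      show "((\<lambda>t. (z * K1 + \<bar>\<nu>\<bar> * K0) * exp (- t)) \<longlongrightarrow> 0) at_top" by real_asymp
    qed
    then show "((?G \<circ> real_of_ereal) \<longlongrightarrow> 0) (at_left \<infinity>)"
      unfolding ereal_tendsto_simps1 .
  qed simp
  then have "0 = (LBINT t:{0<..}. ?g t)"
    by (simp add: interval_integral_to_infinity_eq zero_ereal_def)
  also have "\<dots> = z\<^sup>2 * besselK_moment 2 \<nu> z - z * besselK_moment 1 \<nu> z - (z\<^sup>2 + \<nu>\<^sup>2) * besselK_moment 0 \<nu> z"
    unfolding besselK_moment_def using int[of 0 \<nu>] int[of 1 \<nu>] int[of 2 \<nu>]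
    by (simp add: set_integral_diff del: One_nat_def power_0 power_one_right)
  finally show ?thesis by simp
qed

lemma kummer_solution_besselK:
  "kummer_solution (1/2 - \<nu>) (1 - 2 * \<nu>) (\<lambda>x. exp (x / 2) * x powr \<nu> * besselK \<nu> (x / 2))"
  unfolding kummer_solution_def besselK_eq_moment
proof (intro exI allI impI conjI)
  fix x :: real assume x: "x > 0"
  let ?E = "\<lambda>x. exp (x / 2) * x powr \<nu>"
  let ?K = "\<lambda>n x. besselK_moment n \<nu> (x / 2)"
  let ?w' = "\<lambda>x. ?E x * ((1/2 + \<nu> / x) * ?K 0 x - ?K 1 x / 2)"
  let ?w'' = "\<lambda>x. ?E x * (((1/2 + \<nu> / x)\<^sup>2 - \<nu> / x\<^sup>2) * ?K 0 x - (1/2 + \<nu> / x) * ?K 1 x + ?K 2 x / 4)"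
  have K: "(?K n has_real_derivative - ?K (Suc n) x / 2) (at x)" for n
  proof -
    have "(?K n has_real_derivative (- ?K (Suc n) x) * (1/2)) (at x)"
      by (rule DERIV_chain2[where g = "\<lambda>x. x/2" and f = "besselK_moment n \<nu>", OF besselK_moment_has_derivative])
         (use x in \<open>auto intro!: derivative_eq_intros\<close>)
    then show ?thesis by simp
  qed
  have E: "(?E has_real_derivative ?E x * (1/2 + \<nu> / x)) (at x)"
    using x by (auto intro!: derivative_eq_intros simp: algebra_simps powr_diff)
  have "((\<lambda>x. ?E x * ?K 0 x) has_real_derivative ?E x * (1/2 + \<nu> / x) * ?K 0 x + (- ?K 1 x / 2) * ?E x) (at x)"
    using DERIV_mult[OF E K[of 0]] by simp
  then show "((\<lambda>x. ?E x * ?K 0 x) has_real_derivative ?w' x) (at x)"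
    by (rule DERIV_cong) (simp add: algebra_simps)
  have "((\<lambda>x. (1/2 + \<nu> / x) * ?K 0 x - ?K 1 x / 2) has_real_derivative
      (- \<nu> / x\<^sup>2) * ?K 0 x + (- ?K 1 x / 2) * (1/2 + \<nu> / x) - (- ?K 2 x / 2) / 2) (at x)"
  proof (intro DERIV_diff DERIV_mult DERIV_cdivide)
    show "((\<lambda>x. 1/2 + \<nu> / x) has_real_derivative - \<nu> / x\<^sup>2) (at x)"
      using x by (auto intro!: derivative_eq_intros simp: power2_eq_square)
    show "(?K 0 has_real_derivative - ?K 1 x / 2) (at x)" using K[of 0] by simp
    show "(?K 1 has_real_derivative - ?K 2 x / 2) (at x)" using K[of 1] by (simp add: numeral_2_eq_2)
  qed
  from DERIV_mult[OF E this]
  show "(?w' has_real_derivative ?w'' x) (at x)"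
    by (rule DERIV_cong) (simp add: algebra_simps power2_eq_square)
  have algebra: "x * (((1/2 + \<nu> / x)\<^sup>2 - \<nu> / x\<^sup>2) * k0 - (1/2 + \<nu> / x) * k1 + k2 / 4)
      + (1 - 2 * \<nu> - x) * ((1/2 + \<nu> / x) * k0 - k1 / 2) - (1/2 - \<nu>) * k0
      = ((x / 2)\<^sup>2 * k2 - x / 2 * k1 - ((x / 2)\<^sup>2 + \<nu>\<^sup>2) * k0) / x" for k0 k1 k2 :: real
  proof -
    \<comment> \<open>In terms of \<open>\<nu> / x\<close> the identity is polynomial.\<close>
    obtain n where n: "\<nu> = n * x" using x by (metis nonzero_divide_eq_eq less_irrefl)
    show ?thesis unfolding n using x by (simp add: power2_eq_square field_simps)
  qed
  have "x * ?w'' x + (1 - 2 * \<nu> - x) * ?w' x - (1/2 - \<nu>) * (?E x * ?K 0 x)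
      = ?E x * (x * (((1/2 + \<nu> / x)\<^sup>2 - \<nu> / x\<^sup>2) * ?K 0 x - (1/2 + \<nu> / x) * ?K 1 x + ?K 2 x / 4)
      + (1 - 2 * \<nu> - x) * ((1/2 + \<nu> / x) * ?K 0 x - ?K 1 x / 2) - (1/2 - \<nu>) * ?K 0 x)"
    by (simp only: ring_distribs mult_ac)
  also have "\<dots> = 0"
    unfolding algebra using besselK_moment_ode[of "x / 2" \<nu>] x by simp
  finally show "x * ?w'' x + (1 - 2 * \<nu> - x) * ?w' x - (1/2 - \<nu>) * (?E x * ?K 0 x) = 0" .
qed


text \<open>
  Laplace's method: the substitution \<open>t = 2 * u / sqrt x\<close> turns \<open>(x/2) * (cosh t - 1)\<close> into a quantity
  that tends to \<open>u\<^sup>2\<close> and is at least \<open>u\<^sup>2\<close>, so the integral tends to a Gaussian one.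
\<close>

lemma besselK_asymp:
  "(\<lambda>x. exp (x / 2) * besselK \<nu> (x / 2)) \<sim>[at_top] (\<lambda>x. sqrt pi * x powr (- 1 / 2))"
proof -
  let ?s = "\<lambda>x u. indicator {0..} u *\<^sub>R (exp (- (x / 2) * (cosh (2 * u / sqrt x) - 1)) * cosh (\<nu> * (2 * u / sqrt x))) :: real"
  have "((\<lambda>x. \<integral>u. ?s x u \<partial>lborel) \<longlongrightarrow> (\<integral>u. indicator {0..} u *\<^sub>R exp (- u\<^sup>2) \<partial>lborel)) at_top"
  proof (rule integral_dominated_convergence_at_top)
    \<comment> \<open>The square is completed: \<open>- u\<^sup>2 + \<bar>\<nu>\<bar> * u \<le> (\<bar>\<nu>\<bar> + 1)\<^sup>2 / 4 - u\<close>.\<close>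
    define K where "K = exp ((\<bar>\<nu>\<bar> + 1)\<^sup>2 / 4)"
    have "integrable lborel (\<lambda>u. K * (indicator {0<..} u *\<^sub>R exp (- u)) :: real)"
      using exp_minus_integrable unfolding set_integrable_def
      by (intro Bochner_Integration.integrable_mult_right)
    also have "?this \<longleftrightarrow> integrable lborel (\<lambda>u. indicator {0..} u *\<^sub>R (K * exp (- u)) :: real)"
    proof (rule integrable_cong_AE)
      show "AE u in lborel. K * (indicator {0<..} u *\<^sub>R exp (- u)) = indicator {0..} u *\<^sub>R (K * exp (- u :: real))"
        using AE_lborel_singleton[of 0] by eventually_elim (auto simp: indicator_def)
    qed measurable
    finally show "integrable lborel (\<lambda>u. indicator {0..} u *\<^sub>R (K * exp (- u)) :: real)" .
    show "\<forall>\<^sub>F x in at_top. AE u in lborel. norm (?s x u) \<le> indicator {0..} u *\<^sub>R (K * exp (- u))"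
      using eventually_ge_at_top[of 4]
    proof eventually_elim
      case (elim x)
      have sx: "sqrt x \<ge> 2" "sqrt x > 0" using elim by (auto intro: real_le_rsqrt)
      show ?case
      proof (rule AE_I2)
        fix u :: real
        show "norm (?s x u) \<le> indicator {0..} u *\<^sub>R (K * exp (- u))"
        proof (cases "u \<ge> 0")
          case True
          have "u\<^sup>2 = (x / 2) * ((2 * u / sqrt x)\<^sup>2 / 2)"
            using elim by (simp add: power_divide power_mult_distrib)
          also have "\<dots> \<le> (x / 2) * (cosh (2 * u / sqrt x) - 1)"
            using elim cosh_ge_quadratic[of "2 * u / sqrt x"] by (intro mult_left_mono) auto
          finally have 1: "exp (- (x / 2) * (cosh (2 * u / sqrt x) - 1)) \<le> exp (- u\<^sup>2)" by simp
          have "2 * u / sqrt x \<le> u" using sx True mult_right_mono[OF sx(1) True] by (simp add: field_simps)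
          then have "\<bar>\<nu>\<bar> * (2 * u / sqrt x) \<le> \<bar>\<nu>\<bar> * u" by (intro mult_left_mono) auto
          moreover have "cosh (\<nu> * (2 * u / sqrt x)) \<le> exp (\<bar>\<nu>\<bar> * (2 * u / sqrt x))"
            using True sx by (intro cosh_mult_le_exp) auto
          ultimately have 2: "cosh (\<nu> * (2 * u / sqrt x)) \<le> exp (\<bar>\<nu>\<bar> * u)"
            by (meson exp_le_cancel_iff order_trans)
          have "exp (- (x / 2) * (cosh (2 * u / sqrt x) - 1)) * cosh (\<nu> * (2 * u / sqrt x))
              \<le> exp (- u\<^sup>2) * exp (\<bar>\<nu>\<bar> * u)"
            by (intro mult_mono 1 2) auto
          also have "\<dots> = exp (- u\<^sup>2 + \<bar>\<nu>\<bar> * u)" by (simp only: exp_add)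
          also have "- u\<^sup>2 + \<bar>\<nu>\<bar> * u \<le> (\<bar>\<nu>\<bar> + 1)\<^sup>2 / 4 + (- u)"
            using zero_le_power2[of "u - (\<bar>\<nu>\<bar> + 1) / 2"] by (simp add: power2_eq_square field_simps)
          then have "exp (- u\<^sup>2 + \<bar>\<nu>\<bar> * u) \<le> K * exp (- u)" unfolding K_def exp_add[symmetric] by simp
          finally show ?thesis using True by simp
        qed simp
      qed
    qed
    show "AE u in lborel. ((\<lambda>x. ?s x u) \<longlongrightarrow> indicator {0..} u *\<^sub>R exp (- u\<^sup>2)) at_top"
    proof (rule AE_I2)
      fix u :: real
      have 1: "((\<lambda>x. - (x / 2) * (cosh (2 * u / sqrt x) - 1)) \<longlongrightarrow> - u\<^sup>2) at_top"
        unfolding cosh_field_def by (real_asymp simp: power2_eq_square)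
      have 2: "((\<lambda>x. \<nu> * (2 * u / sqrt x)) \<longlongrightarrow> 0) at_top" by real_asymp
      have "((\<lambda>x. exp (- (x / 2) * (cosh (2 * u / sqrt x) - 1)) * cosh (\<nu> * (2 * u / sqrt x))) \<longlongrightarrow> exp (- u\<^sup>2) * cosh 0) at_top"
        by (intro tendsto_mult tendsto_exp tendsto_cosh 1 2)
      then show "((\<lambda>x. ?s x u) \<longlongrightarrow> indicator {0..} u *\<^sub>R exp (- u\<^sup>2)) at_top"
        by (cases "u \<ge> 0") simp_all
    qed
    show "(\<lambda>u. indicator {0..} u *\<^sub>R exp (- u\<^sup>2) :: real) \<in> borel_measurable lborel" by measurable
    fix x :: real
    have [measurable]: "(\<lambda>u. exp (- (x / 2) * (cosh (2 * u / sqrt x) - 1)) * cosh (\<nu> * (2 * u / sqrt x))) \<in> borel_measurable borel"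
      by (cases "sqrt x = 0") (auto intro!: borel_measurable_continuous_onI continuous_intros)
    show "(\<lambda>u. ?s x u) \<in> borel_measurable lborel" by measurable
  qed
  then have "((\<lambda>x. \<integral>u. ?s x u \<partial>lborel) \<longlongrightarrow> sqrt pi / 2) at_top"
    unfolding has_bochner_integral_integral_eq[OF gaussian_moment_0] .
  then have "(\<lambda>x. \<integral>u. ?s x u \<partial>lborel) \<sim>[at_top] (\<lambda>_. sqrt pi / 2)"
    by (rule tendsto_imp_asymp_equiv_const) simp
  then have "(\<lambda>x. 2 * x powr (- 1 / 2) * (\<integral>u. ?s x u \<partial>lborel)) \<sim>[at_top] (\<lambda>x. 2 * x powr (- 1 / 2) * (sqrt pi / 2))"
    by (intro asymp_equiv_mult asymp_equiv_refl)
  moreover have "\<forall>\<^sub>F x in at_top. 2 * x powr (- 1 / 2) * (\<integral>u. ?s x u \<partial>lborel) = exp (x / 2) * besselK \<nu> (x / 2)"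
    using eventually_gt_at_top[of 0]
  proof eventually_elim
    case (elim x)
    let ?h = "\<lambda>t. indicator {0..} t *\<^sub>R (exp (- (x / 2) * cosh t) * cosh (\<nu> * t)) :: real"
    have "besselK \<nu> (x / 2) = integral\<^sup>L lborel ?h"
      by (simp add: besselK_def set_lebesgue_integral_def)
    also have "\<dots> = \<bar>2 / sqrt x\<bar> *\<^sub>R (\<integral>u. ?h (0 + 2 / sqrt x * u) \<partial>lborel)"
      using elim by (intro lborel_integral_real_affine) auto
    finally have "exp (x / 2) * besselK \<nu> (x / 2) = 2 / sqrt x * (\<integral>u. exp (x / 2) * ?h (0 + 2 / sqrt x * u) \<partial>lborel)"
      using elim by simp
    also have "(\<lambda>u. exp (x / 2) * ?h (0 + 2 / sqrt x * u)) = ?s x"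
    proof
      fix u :: real
      have i: "indicator {0..} (0 + 2 / sqrt x * u) = (indicator {0..} u :: real)"
        using elim by (auto simp: indicator_def zero_le_mult_iff zero_le_divide_iff)
      have e: "exp (- (x / 2) * (cosh (2 * u / sqrt x) - 1)) = exp (x / 2) * exp (- (x / 2) * cosh (2 * u / sqrt x))"
        by (simp add: exp_add[symmetric] algebra_simps)
      show "exp (x / 2) * ?h (0 + 2 / sqrt x * u) = ?s x u"
        unfolding i e by simp
    qed
    also have "2 / sqrt x = 2 * x powr (- 1 / 2)"
      using elim by (simp add: powr_minus powr_half_sqrt field_simps)
    finally show ?case ..
  qed
  ultimately show ?thesis by (rule asymp_equiv_transfer) simp_all
qed

text \<open>
  Both sides, suitably normalised, solve Kummer's equation for \<open>U(1 - \<gamma>, 2 - 2 * \<gamma>, x)\<close> and are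
  asymptotic to \<open>x powr (\<gamma> - 1)\<close>.
\<close>

lemma besselK_eq_shifted_gamma:
  assumes "\<gamma> > 0" "x > 0"
  shows "x powr (\<gamma> - 1/2) * besselK (\<gamma> - 1/2) (x / 2)
       = sqrt pi / Gamma \<gamma> * exp (- x / 2) * shifted_gamma (\<gamma> - 1) (\<gamma> - 1) x"
proof -
  define \<nu> where "\<nu> = \<gamma> - 1/2"
  let ?w = "\<lambda>x. 1 / sqrt pi * (exp (x / 2) * x powr \<nu> * besselK \<nu> (x / 2))"
  have ab: "1/2 - \<nu> = 1 - \<gamma>" "1 - 2 * \<nu> = 2 - \<gamma> - \<gamma>" by (simp_all add: \<nu>_def)
  have "(\<lambda>x. 1 / sqrt pi * x powr \<nu> * (exp (x / 2) * besselK \<nu> (x / 2)))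
      \<sim>[at_top] (\<lambda>x. 1 / sqrt pi * x powr \<nu> * (sqrt pi * x powr (- 1 / 2)))"
    by (intro asymp_equiv_mult asymp_equiv_refl besselK_asymp)
  also have "(\<lambda>x. 1 / sqrt pi * x powr \<nu> * (sqrt pi * x powr (- 1 / 2))) = (\<lambda>x. x powr (- (1 - \<gamma>)))"
  proof
    fix x :: real
    show "1 / sqrt pi * x powr \<nu> * (sqrt pi * x powr (- 1 / 2)) = x powr (- (1 - \<gamma>))"
      by (simp add: \<nu>_def powr_add[symmetric])
  qed
  finally have w: "?w \<sim>[at_top] (\<lambda>x. x powr (- (1 - \<gamma>)))"
    by (simp add: mult_ac)
  have "?w x = 1 / Gamma \<gamma> * shifted_gamma (\<gamma> - 1) (\<gamma> - 1) x"
  proof (rule kummer_solution_unique[OF _ w])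
    show "kummer_solution (1 - \<gamma>) (2 - \<gamma> - \<gamma>) ?w"
      using kummer_solution_cmult[OF kummer_solution_besselK[of \<nu>]] unfolding ab .
    show "kummer_solution (1 - \<gamma>) (2 - \<gamma> - \<gamma>) (\<lambda>x. 1 / Gamma \<gamma> * shifted_gamma (\<gamma> - 1) (\<gamma> - 1) x)"
      by (intro kummer_solution_cmult kummer_solution_shifted_gamma assms)
    show "(\<lambda>x. 1 / Gamma \<gamma> * shifted_gamma (\<gamma> - 1) (\<gamma> - 1) x) \<sim>[at_top] (\<lambda>x. x powr (- (1 - \<gamma>)))"
      by (intro normalised_shifted_gamma_asymp assms)
  qed (use assms in \<open>auto intro!: divide_pos_pos shifted_gamma_pos Gamma_real_pos\<close>)
  then have e: "exp (x / 2) * (x powr \<nu> * besselK \<nu> (x / 2)) = sqrt pi / Gamma \<gamma> * shifted_gamma (\<gamma> - 1) (\<gamma> - 1) x"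
    by (simp add: field_simps)
  have "exp (- x / 2) * (exp (x / 2) * y) = y" for y by (simp add: exp_minus)
  from this[of "x powr \<nu> * besselK \<nu> (x / 2)"] show ?thesis
    unfolding e by (simp add: \<nu>_def mult_ac)
qed

section \<open>Differences of gamma variables\<close>

text \<open>
  For independent gamma variables \<open>X\<close>, \<open>Y\<close> of shapes \<open>\<alpha>\<close>, \<open>\<beta>\<close> and scale \<open>2\<close>, the density of \<open>X - Y\<close>
  at \<open>x > 0\<close> is \<open>2 powr (-\<alpha>-\<beta>) * exp (-x/2) * gamma_difference \<alpha> \<beta> x\<close>.
\<close>

definition gamma_difference :: "real \<Rightarrow> real \<Rightarrow> real \<Rightarrow> real" where
  "gamma_difference \<alpha> \<beta> x = shifted_gamma (\<alpha> - 1) (\<beta> - 1) x / (Gamma \<alpha> * Gamma \<beta>)"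

lemma gamma_difference_nonneg:
  assumes "\<alpha> > 0" "\<beta> > 0" "x > 0 \<or> x = 0 \<and> \<alpha> + \<beta> > 1"
  shows "gamma_difference \<alpha> \<beta> x \<ge> 0"
  unfolding gamma_difference_def
  using assms shifted_gamma_pos[of "\<beta> - 1" x "\<alpha> - 1"] Gamma_real_pos[of \<alpha>] Gamma_real_pos[of \<beta>]
  by (intro divide_nonneg_pos mult_pos_pos less_imp_le) auto

text \<open>
  In terms of characteristic functions this is
  \<open>1/(1-2it) + 1/(1+2it) = 2/((1-2it)(1+2it))\<close>; the proof is an integration by parts.
\<close>

lemma gamma_difference_step:
  assumes "\<alpha> > 0" "\<beta> > 0" "x > 0 \<or> x = 0 \<and> \<alpha> + \<beta> > 1"
  shows "gamma_difference (\<alpha> + 1) \<beta> x + gamma_difference \<alpha> (\<beta> + 1) x = gamma_difference (\<alpha> + 1) (\<beta> + 1) x"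
proof -
  have G: "Gamma (\<alpha> + 1) = \<alpha> * Gamma \<alpha>" "Gamma (\<beta> + 1) = \<beta> * Gamma \<beta>"
    using assms by (auto intro!: Gamma_plus1 elim!: nonpos_Ints_cases)
  have "Gamma \<alpha> > 0" "Gamma \<beta> > 0" using assms by (auto intro: Gamma_real_pos)
  moreover have "shifted_gamma \<alpha> \<beta> x = \<alpha> * shifted_gamma (\<alpha> - 1) \<beta> x + \<beta> * shifted_gamma \<alpha> (\<beta> - 1) x"
    using assms by (intro shifted_gamma_by_parts) auto
  ultimately show ?thesis using assms
    unfolding gamma_difference_def G by (simp add: add_divide_distrib mult_ac)
qed

lemma sum_choose_Suc:
  fixes g :: "nat \<Rightarrow> 'a::comm_semiring_1"
  shows "(\<Sum>j\<le>Suc k. of_nat (Suc k choose j) * g j) = (\<Sum>j\<le>k. of_nat (k choose j) * (g j + g (Suc j)))"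
proof -
  have "(\<Sum>j\<le>Suc k. of_nat (Suc k choose j) * g j)
      = (g 0 + (\<Sum>j\<le>k. of_nat (k choose Suc j) * g (Suc j))) + (\<Sum>j\<le>k. of_nat (k choose j) * g (Suc j))"
    by (simp only: sum.atMost_Suc_shift) (simp add: sum.distrib algebra_simps)
  also have "g 0 + (\<Sum>j\<le>k. of_nat (k choose Suc j) * g (Suc j)) = (\<Sum>j\<le>Suc k. of_nat (k choose j) * g j)"
    by (simp only: sum.atMost_Suc_shift) simp
  also have "\<dots> = (\<Sum>j\<le>k. of_nat (k choose j) * g j)" by (simp add: binomial_eq_0)
  finally show ?thesis by (simp add: sum.distrib ring_distribs)
qed

text \<open>
  Pascal's rule splits the sum for \<open>k + 1\<close> into pairs to which \<open>gamma_difference_step\<close> applies; what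
  results is the sum for \<open>k\<close> with \<open>\<alpha> + 1\<close> and \<open>\<beta> + 1\<close>.
\<close>

lemma sum_choose_gamma_difference:
  assumes "\<alpha> > 0" "\<beta> > 0" "x > 0 \<or> x = 0 \<and> \<alpha> + \<beta> > 1"
  shows "(\<Sum>j\<le>k. real (k choose j) * gamma_difference (\<alpha> + real (k - j)) (\<beta> + real j) x)
       = gamma_difference (\<alpha> + real k) (\<beta> + real k) x"
  using assms
proof (induction k arbitrary: \<alpha> \<beta>)
  case (Suc k)
  have "(\<Sum>j\<le>Suc k. real (Suc k choose j) * gamma_difference (\<alpha> + real (Suc k - j)) (\<beta> + real j) x)
      = (\<Sum>j\<le>k. real (k choose j) * gamma_difference (\<alpha> + 1 + real (k - j)) (\<beta> + 1 + real j) x)"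
    unfolding sum_choose_Suc
  proof (rule sum.cong)
    fix j assume "j \<in> {..k}"
    then have "gamma_difference (\<alpha> + real (Suc k - j)) (\<beta> + real j) x + gamma_difference (\<alpha> + real (Suc k - Suc j)) (\<beta> + real (Suc j)) x
       = gamma_difference (\<alpha> + real (k - j) + 1) (\<beta> + real j) x + gamma_difference (\<alpha> + real (k - j)) (\<beta> + real j + 1) x"
      by (simp add: Suc_diff_le add_ac)
    also have "\<dots> = gamma_difference (\<alpha> + real (k - j) + 1) (\<beta> + real j + 1) x"
      using Suc.prems by (intro gamma_difference_step) auto
    finally show "real (k choose j) * (gamma_difference (\<alpha> + real (Suc k - j)) (\<beta> + real j) x + gamma_difference (\<alpha> + real (Suc k - Suc j)) (\<beta> + real (Suc j)) x)
       = real (k choose j) * gamma_difference (\<alpha> + 1 + real (k - j)) (\<beta> + 1 + real j) x"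
      by (simp add: add_ac)
  qed simp
  also have "\<dots> = gamma_difference (\<alpha> + 1 + real k) (\<beta> + 1 + real k) x"
    using Suc.prems by (intro Suc.IH) auto
  finally show ?case by (simp add: add_ac)
qed simp

section \<open>The noncentral chi-square density as a series\<close>

lemma power_div_Gamma_bounded:
  fixes l s :: real
  assumes "l \<ge> 0" "s > 0"
  obtains B where "B \<ge> 0" "\<And>k. l ^ k / Gamma (s + real k) \<le> B"
proof -
  obtain N where N: "real N \<ge> 2 * l" using real_arch_simple by blast
  have G: "Gamma (s + real k) > 0" for k using assms by (intro Gamma_real_pos) auto
  have "summable (\<lambda>k. l ^ k / Gamma (s + real k))"
  proof (rule summable_ratio_test[of "1/2" N])
    fix k assume k: "k \<ge> N"
    have "s + real k \<notin> \<int>\<^sub>\<le>\<^sub>0" using assms by (auto elim!: nonpos_Ints_cases)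
    from Gamma_plus1[OF this] have "Gamma (s + real (Suc k)) = (s + real k) * Gamma (s + real k)"
      by (simp add: add_ac)
    then have "l ^ Suc k / Gamma (s + real (Suc k)) = (l / (s + real k)) * (l ^ k / Gamma (s + real k))"
      by simp
    also have "\<dots> \<le> 1/2 * (l ^ k / Gamma (s + real k))"
    proof (rule mult_right_mono)
      have "real k \<ge> real N" using k by simp
      then have "2 * l \<le> s + real k" using N assms by linarith
      then show "l / (s + real k) \<le> 1/2" using assms by (simp add: field_simps)
      show "0 \<le> l ^ k / Gamma (s + real k)" using G[of k] assms by simp
    qed
    finally show "norm (l ^ Suc k / Gamma (s + real (Suc k))) \<le> 1/2 * norm (l ^ k / Gamma (s + real k))"
      using G[of k] G[of "Suc k"] assms by (simp add: abs_of_pos)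
  qed simp
  then have "Bseq (\<lambda>k. l ^ k / Gamma (s + real k))"
    by (intro convergent_imp_Bseq summable_LIMSEQ_zero[THEN convergentI])
  then obtain B where "B > 0" "\<And>k. norm (l ^ k / Gamma (s + real k)) \<le> B"
    by (auto elim: BseqE)
  then show ?thesis by (intro that[of B]) (auto intro: order_trans[OF abs_ge_self])
qed

definition nc_chi_square_term :: "real \<Rightarrow> real \<Rightarrow> nat \<Rightarrow> real \<Rightarrow> real" where
  "nc_chi_square_term r l k x =
     2 powr (- r / 2) * exp (- (x + l) / 2) * ((l / 4) ^ k / (fact k * Gamma (r / 2 + real k))) * x powr (r / 2 + real k - 1)"

lemma nc_chi_square_term_nonneg:
  assumes "r > 0" "l \<ge> 0"
  shows "nc_chi_square_term r l k x \<ge> 0"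
  unfolding nc_chi_square_term_def using assms Gamma_real_pos[of "r / 2 + real k"]
  by (auto intro!: mult_nonneg_nonneg divide_nonneg_pos mult_pos_pos)

text \<open>
  The bound serves to show that the convolution integral is finite. It holds because
  \<open>(l*x/4)^k / (k! * \<Gamma>(r/2+k)) \<le> B * (x/4)^k / k!\<close>, where \<open>B\<close> bounds \<open>l^k / \<Gamma>(r/2+k)\<close>; the
  resulting factor \<open>exp (x/4)\<close> uses up only half of the decay of \<open>exp (-x/2)\<close>.
\<close>

lemma nc_chi_square_series:
  assumes "r > 0" "l \<ge> 0"
  obtains C where "C \<ge> 0"
    "\<And>x. x > 0 \<Longrightarrow> (\<lambda>k. nc_chi_square_term r l k x) sums nc_chi_square_density r l x"
    "\<And>x. x > 0 \<Longrightarrow> nc_chi_square_density r l x \<le> C * (exp (- x / 4) * x powr (r / 2 - 1))"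
proof -
  obtain B where B: "B \<ge> 0" "\<And>k. l ^ k / Gamma (r / 2 + real k) \<le> B"
    using power_div_Gamma_bounded[of l "r / 2"] assms by auto
  have G: "Gamma (r / 2 + real k) > 0" for k using assms by (intro Gamma_real_pos) auto
  let ?c = "\<lambda>x k. (l * x / 4) ^ k / (fact k * Gamma (r / 2 + real k))"
  define P where "P = (\<lambda>x. 2 powr (- r / 2) * exp (- (x + l) / 2) * x powr (r / 2 - 1))"
  have term_eq: "nc_chi_square_term r l k x = P x * ?c x k" if "x > 0" for k x
  proof -
    have "x powr (r / 2 + real k - 1) = x powr (r / 2 - 1) * x ^ k"
      using that by (simp add: powr_realpow[symmetric] powr_add[symmetric] algebra_simps)
    then show ?thesis
      by (simp add: nc_chi_square_term_def P_def power_mult_distrib power_divide)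
  qed
  have c_le: "?c x k \<le> B * ((x / 4) ^ k / fact k)" "?c x k \<ge> 0" if "x > 0" for x k
  proof -
    have "?c x k = (l ^ k / Gamma (r / 2 + real k)) * ((x / 4) ^ k / fact k)"
      by (simp add: power_mult_distrib power_divide)
    also have "\<dots> \<le> B * ((x / 4) ^ k / fact k)"
      using that by (intro mult_right_mono B) auto
    finally show "?c x k \<le> B * ((x / 4) ^ k / fact k)" .
    show "?c x k \<ge> 0" using assms that G[of k] by (intro divide_nonneg_pos mult_pos_pos) auto
  qed
  have exp_sums: "(\<lambda>k. B * ((x / 4) ^ k / fact k)) sums (B * exp (x / 4))" for x
    using sums_mult[OF exp_converges[of "x / 4"], of B] by (simp only: real_scaleR_def divide_inverse mult.commute)
  have c_summable: "summable (?c x)" if "x > 0" for x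
    by (rule summable_comparison_test'[OF sums_summable[OF exp_sums[of x]], of 0])
       (simp only: real_norm_def abs_of_nonneg[OF c_le(2)[OF that]] c_le(1)[OF that])
  have density: "nc_chi_square_density r l x = P x * suminf (?c x)" if x: "x > 0" for x
  proof (cases "l = 0")
    case True
    have "suminf (?c x) = ?c x 0"
      by (subst suminf_finite[of "{0}"]) (auto simp: True)
    then show ?thesis using x
      by (simp add: True nc_chi_square_density_def chi_square_density_def P_def powr_minus field_simps)
  next
    case False
    then have l: "l > 0" using assms by simp
    have I: "besselI (r / 2 - 1) (sqrt (l * x)) = (sqrt (l * x) / 2) powr (r / 2 - 1) * suminf (?c x)"
    proof -
      have "rGamma (r / 2 - 1 + real k + 1) / fact k * (sqrt (l * x) / 2) ^ (2 * k) = ?c x k" for k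
      proof -
        have "(sqrt (l * x) / 2) ^ (2 * k) = (l * x / 4) ^ k"
          using l x by (simp add: power_mult power_divide)
        moreover have "r / 2 - 1 + real k + 1 = r / 2 + real k" by simp
        ultimately show ?thesis 
          by (simp only: rGamma_inverse_Gamma divide_inverse inverse_mult_distrib mult_ac)
      qed
      then show ?thesis by (simp add: besselI_def)
    qed
    have p: "(x / l) powr (r / 4 - 1 / 2) * (sqrt (l * x) / 2) powr (r / 2 - 1)
        = x powr (r / 2 - 1) * 2 powr (- (r / 2 - 1))"
    proof -
      define h where "h = r / 4 - 1 / 2"
      have h: "r / 2 - 1 = 2 * h" by (simp add: h_def)
      have "sqrt (l * x) powr (2 * h) = (l * x) powr h"
        using l x by (simp add: powr_half_sqrt[symmetric] powr_powr)
      moreover have "x powr (2 * h) = (x * x) powr h"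
        using x by (simp add: powr_mult powr_add[symmetric])
      moreover have "(x / l) powr h * (l * x) powr h = (x * x) powr h"
        using l x by (simp add: powr_mult[symmetric])
      ultimately show ?thesis unfolding h h_def[symmetric]
        using l x by (simp add: powr_divide powr_minus field_simps)
    qed
    have two: "1 / 2 * 2 powr (- (r / 2 - 1)) = 2 powr (- r / 2)"
    proof -
      have "- (r / 2 - 1) = 1 + - r / 2" by simp
      then show ?thesis by (simp only: powr_add) simp
    qed
    have "nc_chi_square_density r l x = exp (- (x + l) / 2) * ((x / l) powr (r / 4 - 1 / 2) * (sqrt (l * x) / 2) powr (r / 2 - 1))
         * (1 / 2) * suminf (?c x)"
      using x False by (simp add: nc_chi_square_density_def I)
    also have "\<dots> = (1 / 2 * 2 powr (- (r / 2 - 1))) * exp (- (x + l) / 2) * x powr (r / 2 - 1) * suminf (?c x)"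
      unfolding p by (simp only: mult_ac)
    finally show ?thesis unfolding two P_def by simp
  qed
  show ?thesis
  proof (rule that)
    let ?C = "2 powr (- r / 2) * B * exp (- l / 2)"
    show "?C \<ge> 0" using B by simp
    fix x :: real assume x: "x > 0"
    show "(\<lambda>k. nc_chi_square_term r l k x) sums nc_chi_square_density r l x"
      unfolding term_eq[OF x] density[OF x] by (intro sums_mult summable_sums c_summable x)
    have "suminf (?c x) \<le> B * exp (x / 4)"
      unfolding sums_unique[OF exp_sums]
      by (rule suminf_le[OF c_le(1)[OF x] c_summable[OF x] sums_summable[OF exp_sums]])
    then have "nc_chi_square_density r l x \<le> P x * (B * exp (x / 4))"
      unfolding density[OF x] by (rule mult_left_mono) (simp add: P_def)
    also have "\<dots> = 2 powr (- r / 2) * B * x powr (r / 2 - 1) * (exp (- (x + l) / 2) * exp (x / 4))"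
      by (simp add: P_def)
    also have "exp (- (x + l) / 2) * exp (x / 4) = exp (- l / 2) * exp (- x / 4)"
      by (simp add: exp_add[symmetric] field_simps)
    finally show "nc_chi_square_density r l x \<le> ?C * (exp (- x / 4) * x powr (r / 2 - 1))"
      by (simp add: mult_ac)
  qed
qed

lemma nc_chi_square_density_nonpos: "x \<le> 0 \<Longrightarrow> nc_chi_square_density r l x = 0"
  by (simp add: nc_chi_square_density_def chi_square_density_def)

lemma nc_chi_square_density_nonneg:
  assumes "r > 0" "l \<ge> 0"
  shows "nc_chi_square_density r l x \<ge> 0"
proof (cases "x > 0")
  case True
  obtain C where "(\<lambda>k. nc_chi_square_term r l k x) sums nc_chi_square_density r l x"
    using nc_chi_square_series[OF assms] True by metis
  then show ?thesis
    by (rule sums_le[OF _ sums_zero, rotated]) (use assms in \<open>auto intro: nc_chi_square_term_nonneg\<close>)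
qed (simp add: nc_chi_square_density_nonpos)

section \<open>The convolution integral of two noncentral chi-square densities\<close>

text \<open>
  For independent \<open>V\<close>, \<open>V'\<close> with noncentralities \<open>l\<close>, \<open>l'\<close>, the density of \<open>V - V'\<close> at \<open>y > 0\<close> is
  \<open>2 powr (-r) * exp (-(y + l + l') / 2)\<close> times the sum of these terms over \<open>k\<close>.
\<close>

definition nc_difference_term :: "real \<Rightarrow> real \<Rightarrow> real \<Rightarrow> real \<Rightarrow> nat \<Rightarrow> real" where
  "nc_difference_term r l l' y k = (\<Sum>j\<le>k. real (k choose j) / fact k * (l / 4) ^ (k - j) * (l' / 4) ^ j
       * gamma_difference (r / 2 + real (k - j)) (r / 2 + real j) y)"

lemma nc_difference_term_nonneg:
  assumes "r > 0" "l \<ge> 0" "l' \<ge> 0" "y > 0 \<or> y = 0 \<and> r > 1"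
  shows "nc_difference_term r l l' y k \<ge> 0"
  unfolding nc_difference_term_def using assms
  by (intro sum_nonneg mult_nonneg_nonneg gamma_difference_nonneg) auto

lemma nc_difference_term_swap:
  "nc_difference_term r l' l y k = (\<Sum>j\<le>k. real (k choose j) / fact k * (l / 4) ^ (k - j) * (l' / 4) ^ j
       * gamma_difference (r / 2 + real j) (r / 2 + real (k - j)) y)"
  unfolding nc_difference_term_def
  by (subst sum.atLeastAtMost_rev[of _ 0 k, simplified atLeast0AtMost])
     (auto intro!: sum.cong simp: binomial_symmetric[symmetric])

text \<open>
  For equal noncentralities the powers of \<open>l\<close> leave the sum, which then collapses.
\<close>

lemma nc_difference_term_equal:
  assumes "r > 0" "y > 0 \<or> y = 0 \<and> r > 1"
  shows "nc_difference_term r l l y k = (l / 4) ^ k / fact k * gamma_difference (r / 2 + real k) (r / 2 + real k) y"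
proof -
  have "nc_difference_term r l l y k = (\<Sum>j\<le>k. (l / 4) ^ k / fact k * (real (k choose j) * gamma_difference (r / 2 + real (k - j)) (r / 2 + real j) y))"
    unfolding nc_difference_term_def
  proof (rule sum.cong)
    fix j assume "j \<in> {..k}"
    then have "(l / 4) ^ k = (l / 4) ^ (k - j) * (l / 4) ^ j" by (simp add: power_add[symmetric])
    then show "real (k choose j) / fact k * (l / 4) ^ (k - j) * (l / 4) ^ j
       * gamma_difference (r / 2 + real (k - j)) (r / 2 + real j) y
      = (l / 4) ^ k / fact k * (real (k choose j) * gamma_difference (r / 2 + real (k - j)) (r / 2 + real j) y)"
      by simp
  qed simp
  also have "\<dots> = (l / 4) ^ k / fact k * gamma_difference (r / 2 + real k) (r / 2 + real k) y"
    unfolding sum_distrib_left[symmetric] using assms by (subst sum_choose_gamma_difference) auto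
  finally show ?thesis .
qed

lemma nn_integral_nc_chi_square_term_product:
  assumes r: "r > 0" and l: "l \<ge> 0" "l' \<ge> 0" and y: "y > 0 \<or> y = 0 \<and> r > 1"
  shows "(\<integral>\<^sup>+v. ennreal (indicator {0<..} v * (nc_chi_square_term r l' j v * nc_chi_square_term r l m (v + y))) \<partial>lborel)
    = ennreal (2 powr (- r) * exp (- (y + l + l') / 2) * ((l / 4) ^ m / fact m * ((l' / 4) ^ j / fact j)
        * gamma_difference (r / 2 + real m) (r / 2 + real j) y))"
proof -
  define A where "A = 2 powr (- r) * exp (- (y + l + l') / 2) * ((l / 4) ^ m / (fact m * Gamma (r / 2 + real m)))
       * ((l' / 4) ^ j / (fact j * Gamma (r / 2 + real j)))"
  let ?g = "\<lambda>v. exp (- v) * (v + y) powr (r / 2 + real m - 1) * v powr (r / 2 + real j - 1)"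
  have eq: "indicator {0<..} v * (nc_chi_square_term r l' j v * nc_chi_square_term r l m (v + y))
      = A * (indicator {0<..} v *\<^sub>R ?g v)" for v
  proof -
    have "2 powr (- r / 2) * 2 powr (- r / 2) = (2 powr (- r) :: real)"
      by (simp add: powr_add[symmetric])
    moreover have "exp (- (v + l') / 2) * exp (- (v + y + l) / 2) = exp (- (y + l + l') / 2) * exp (- v)"
      by (simp add: exp_add[symmetric] field_simps)
    moreover have "nc_chi_square_term r l' j v * nc_chi_square_term r l m (v + y) =
       (2 powr (- r / 2) * 2 powr (- r / 2)) * (exp (- (v + l') / 2) * exp (- (v + y + l) / 2))
        * ((l / 4) ^ m / (fact m * Gamma (r / 2 + real m)))
        * ((l' / 4) ^ j / (fact j * Gamma (r / 2 + real j)))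
        * (v + y) powr (r / 2 + real m - 1) * v powr (r / 2 + real j - 1)"
      unfolding nc_chi_square_term_def by (simp only: mult_ac)
    ultimately show ?thesis by (simp add: A_def mult_ac)
  qed
  have int: "integrable lborel (\<lambda>v. indicator {0<..} v *\<^sub>R ?g v)"
    using shifted_gamma_integrable[of "r / 2 + real j - 1" y "r / 2 + real m - 1"] assms
    by (auto simp: set_integrable_def)
  have "Gamma (r / 2 + real m) > 0" "Gamma (r / 2 + real j) > 0"
    using r by (auto intro!: Gamma_real_pos)
  then have "A \<ge> 0" unfolding A_def using l by simp
  then have "(\<integral>\<^sup>+v. ennreal (A * (indicator {0<..} v *\<^sub>R ?g v)) \<partial>lborel)
      = ennreal (\<integral>v. A * (indicator {0<..} v *\<^sub>R ?g v) \<partial>lborel)"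
    by (intro nn_integral_eq_integral Bochner_Integration.integrable_mult_right int) (auto simp: indicator_def)
  also have "(\<integral>v. A * (indicator {0<..} v *\<^sub>R ?g v) \<partial>lborel) = A * shifted_gamma (r / 2 + real m - 1) (r / 2 + real j - 1) y"
    by (simp add: shifted_gamma_def set_lebesgue_integral_def)
  also have "\<dots> = 2 powr (- r) * exp (- (y + l + l') / 2) * ((l / 4) ^ m / fact m * ((l' / 4) ^ j / fact j)
        * gamma_difference (r / 2 + real m) (r / 2 + real j) y)"
    by (simp add: A_def gamma_difference_def mult_ac)
  finally show ?thesis unfolding eq .
qed

text \<open>
  Both series are multiplied by the Cauchy product and integrated term by term. Summability of the
  result is the finiteness of the integral, for which the bound in \<open>nc_chi_square_series\<close> leaves an
  integrand of the form \<open>exp (-v/2) * (v+y) powr (r/2-1) * v powr (r/2-1)\<close>.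
\<close>

lemma nn_integral_nc_chi_square_correlation:
  assumes r: "r > 0" and l: "l \<ge> 0" "l' \<ge> 0" and y: "y > 0 \<or> y = 0 \<and> r > 1"
  shows "summable (nc_difference_term r l l' y)"
    and "(\<integral>\<^sup>+v. ennreal (nc_chi_square_density r l (v + y)) * ennreal (nc_chi_square_density r l' v) \<partial>lborel)
      = ennreal (2 powr (- r) * exp (- (y + l + l') / 2) * suminf (nc_difference_term r l l' y))"
proof -
  have y0: "y \<ge> 0" using y by auto
  let ?f = "nc_chi_square_density r l" and ?f' = "nc_chi_square_density r l'"
  let ?I = "\<integral>\<^sup>+v. ennreal (?f (v + y)) * ennreal (?f' v) \<partial>lborel"
  define P where "P = 2 powr (- r) * exp (- (y + l + l') / 2)"
  have P: "P > 0" by (simp add: P_def)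
  obtain C where C: "C \<ge> 0" "\<And>x. x > 0 \<Longrightarrow> (\<lambda>k. nc_chi_square_term r l k x) sums ?f x"
    "\<And>x. x > 0 \<Longrightarrow> ?f x \<le> C * (exp (- x / 4) * x powr (r / 2 - 1))"
    using nc_chi_square_series[OF r l(1)] by metis
  obtain C' where C': "C' \<ge> 0" "\<And>x. x > 0 \<Longrightarrow> (\<lambda>k. nc_chi_square_term r l' k x) sums ?f' x"
    "\<And>x. x > 0 \<Longrightarrow> ?f' x \<le> C' * (exp (- x / 4) * x powr (r / 2 - 1))"
    using nc_chi_square_series[OF r l(2)] by metis
  let ?t = "\<lambda>j m v. indicator {0<..} v * (nc_chi_square_term r l' j v * nc_chi_square_term r l m (v + y))"
  have t_nonneg: "?t j m v \<ge> 0" for j m v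
    using r l by (intro mult_nonneg_nonneg nc_chi_square_term_nonneg) auto
  have [measurable]: "?t j m \<in> borel_measurable lborel" for j m
    unfolding nc_chi_square_term_def by measurable
  have "?I = (\<integral>\<^sup>+v. (\<Sum>k. ennreal (\<Sum>j\<le>k. ?t j (k - j) v)) \<partial>lborel)"
  proof (rule nn_integral_cong)
    fix v :: real
    show "ennreal (?f (v + y)) * ennreal (?f' v) = (\<Sum>k. ennreal (\<Sum>j\<le>k. ?t j (k - j) v))"
    proof (cases "v > 0")
      case True
      have "(\<lambda>k. \<Sum>j\<le>k. nc_chi_square_term r l' j v * nc_chi_square_term r l (k - j) (v + y))
          sums ((\<Sum>k. nc_chi_square_term r l' k v) * (\<Sum>k. nc_chi_square_term r l k (v + y)))"
        using C(2)[of "v + y"] C'(2)[of v] True y0 r l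
        by (intro Cauchy_product_sums) (auto simp: nc_chi_square_term_nonneg sums_summable)
      also have "(\<Sum>k. nc_chi_square_term r l' k v) = ?f' v"
        using sums_unique[OF C'(2)[OF True]] by simp
      also have "(\<Sum>k. nc_chi_square_term r l k (v + y)) = ?f (v + y)"
        using sums_unique[OF C(2)[of "v + y"]] True y0 by simp
      finally have "(\<lambda>k. \<Sum>j\<le>k. ?t j (k - j) v) sums (?f' v * ?f (v + y))" using True by simp
      then have "(\<Sum>k. ennreal (\<Sum>j\<le>k. ?t j (k - j) v)) = ennreal (?f' v * ?f (v + y))"
        by (intro suminf_ennreal_eq sum_nonneg t_nonneg)
      then show ?thesis
        using r l by (simp add: ennreal_mult nc_chi_square_density_nonneg mult.commute)
    qed (simp add: nc_chi_square_density_nonpos)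
  qed
  also have "\<dots> = (\<Sum>k. \<integral>\<^sup>+v. ennreal (\<Sum>j\<le>k. ?t j (k - j) v) \<partial>lborel)"
    by (intro nn_integral_suminf) measurable
  also have "(\<lambda>k. \<integral>\<^sup>+v. ennreal (\<Sum>j\<le>k. ?t j (k - j) v) \<partial>lborel) = (\<lambda>k. ennreal (P * nc_difference_term r l l' y k))"
  proof
    fix k
    have "(\<integral>\<^sup>+v. ennreal (\<Sum>j\<le>k. ?t j (k - j) v) \<partial>lborel) = (\<integral>\<^sup>+v. (\<Sum>j\<le>k. ennreal (?t j (k - j) v)) \<partial>lborel)"
      by (subst sum_ennreal[symmetric]) (use t_nonneg in auto)
    also have "\<dots> = (\<Sum>j\<le>k. \<integral>\<^sup>+v. ennreal (?t j (k - j) v) \<partial>lborel)"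
      by (intro nn_integral_sum) measurable
    also have "\<dots> = (\<Sum>j\<le>k. ennreal (P * (real (k choose j) / fact k * (l / 4) ^ (k - j) * (l' / 4) ^ j
       * gamma_difference (r / 2 + real (k - j)) (r / 2 + real j) y)))"
    proof (rule sum.cong)
      fix j assume "j \<in> {..k}"
      then have "real (k choose j) / fact k = 1 / (fact (k - j) * fact j)"
        by (simp add: binomial_fact mult.commute)
      then show "(\<integral>\<^sup>+v. ennreal (?t j (k - j) v) \<partial>lborel) = ennreal (P * (real (k choose j) / fact k * (l / 4) ^ (k - j) * (l' / 4) ^ j
       * gamma_difference (r / 2 + real (k - j)) (r / 2 + real j) y))"
        unfolding nn_integral_nc_chi_square_term_product[OF assms] P_def by simp
    qed simp
    also have "\<dots> = ennreal (\<Sum>j\<le>k. P * (real (k choose j) / fact k * (l / 4) ^ (k - j) * (l' / 4) ^ j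
       * gamma_difference (r / 2 + real (k - j)) (r / 2 + real j) y))"
    proof (rule sum_ennreal)
      fix j
      have "gamma_difference (r / 2 + real (k - j)) (r / 2 + real j) y \<ge> 0"
        using r y by (intro gamma_difference_nonneg) auto
      then show "0 \<le> P * (real (k choose j) / fact k * (l / 4) ^ (k - j) * (l' / 4) ^ j
         * gamma_difference (r / 2 + real (k - j)) (r / 2 + real j) y)"
        using P l by (intro mult_nonneg_nonneg) auto
    qed
    finally show "(\<integral>\<^sup>+v. ennreal (\<Sum>j\<le>k. ?t j (k - j) v) \<partial>lborel) = ennreal (P * nc_difference_term r l l' y k)"
      by (simp add: nc_difference_term_def sum_distrib_left)
  qed
  finally have I: "?I = (\<Sum>k. ennreal (P * nc_difference_term r l l' y k))" .

  let ?g = "\<lambda>v. exp (- (1/2) * v) * (v + y) powr (r / 2 - 1) * v powr (r / 2 - 1)"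
  have "?I \<le> (\<integral>\<^sup>+v. ennreal ((C * C' * exp (- y / 4)) * (indicator {0<..} v *\<^sub>R ?g v)) \<partial>lborel)"
  proof (rule nn_integral_mono)
    fix v :: real
    show "ennreal (?f (v + y)) * ennreal (?f' v) \<le> ennreal ((C * C' * exp (- y / 4)) * (indicator {0<..} v *\<^sub>R ?g v))"
    proof (cases "v > 0")
      case True
      have "?f (v + y) * ?f' v \<le> (C * (exp (- (v + y) / 4) * (v + y) powr (r / 2 - 1))) * (C' * (exp (- v / 4) * v powr (r / 2 - 1)))"
        using True y0 r l C(1) C'(1) by (intro mult_mono C(3) C'(3)) (auto simp: nc_chi_square_density_nonneg)
      also have "\<dots> = C * C' * (exp (- (v + y) / 4) * exp (- v / 4)) * (v + y) powr (r / 2 - 1) * v powr (r / 2 - 1)"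
        by (simp only: mult_ac)
      also have "exp (- (v + y) / 4) * exp (- v / 4) = exp (- y / 4) * exp (- (1/2) * v)"
        by (simp add: exp_add[symmetric] field_simps)
      finally have "?f (v + y) * ?f' v \<le> (C * C' * exp (- y / 4)) * ?g v" by (simp add: mult_ac)
      then show ?thesis using True r l
        by (simp add: ennreal_mult[symmetric] nc_chi_square_density_nonneg ennreal_leI)
    qed (simp add: nc_chi_square_density_nonpos)
  qed
  also have "\<dots> < \<infinity>"
  proof -
    have "integrable lborel (\<lambda>v. (C * C' * exp (- y / 4)) * (indicator {0<..} v *\<^sub>R ?g v))"
      using shifted_gamma_integrand_integrable[of "1/2" "r / 2 - 1" y "r / 2 - 1"] r y
      by (intro Bochner_Integration.integrable_mult_right) (auto simp: set_integrable_def)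
    then show ?thesis
      by (subst nn_integral_eq_integral) (auto intro!: AE_I2 mult_nonneg_nonneg C(1) C'(1))
  qed
  finally have fin: "(\<Sum>k. ennreal (P * nc_difference_term r l l' y k)) \<noteq> \<top>" unfolding I by simp
  have nn: "P * nc_difference_term r l l' y k \<ge> 0" for k
    using P r l y by (intro mult_nonneg_nonneg nc_difference_term_nonneg) auto
  have sm: "summable (\<lambda>k. P * nc_difference_term r l l' y k)"
    by (rule summable_suminf_not_top[OF nn fin])
  then show "summable (nc_difference_term r l l' y)"
    using P by (subst (asm) summable_cmult_iff) auto
  then show "?I = ennreal (2 powr (- r) * exp (- (y + l + l') / 2) * suminf (nc_difference_term r l l' y))"
    unfolding I P_def[symmetric] by (subst suminf_ennreal2[OF nn sm]) (simp add: suminf_mult)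
qed

section \<open>The density of the difference\<close>

lemma at_zero_by_limit_eqI:
  assumes "\<And>y. y > 0 \<Longrightarrow> f y = g y" and "x \<ge> 0" and "x = 0 \<Longrightarrow> (g \<longlongrightarrow> g 0) (at_right 0)"
  shows "at_zero_by_limit f x = g x"
proof (cases "x = 0")
  case True
  have "\<forall>\<^sub>F y in at_right 0. g y = f y"
    using assms(1) by (auto simp: eventually_at_filter)
  then have "(f \<longlongrightarrow> g 0) (at_right 0)"
    using assms(3)[OF True] by (rule Lim_transform_eventually[rotated])
  then show ?thesis
    by (simp add: True at_zero_by_limit_def tendsto_Lim)
qed (use assms in \<open>auto simp: at_zero_by_limit_def\<close>)

lemma gamma_difference_tendsto_at_0:
  assumes "\<alpha> > 0" "\<beta> > 0" "\<alpha> + \<beta> > 1"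
  shows "(gamma_difference \<alpha> \<beta> \<longlongrightarrow> gamma_difference \<alpha> \<beta> 0) (at_right 0)"
proof -
  have "Gamma \<alpha> \<noteq> 0" "Gamma \<beta> \<noteq> 0" using assms by (metis Gamma_real_pos less_irrefl)+
  then show ?thesis unfolding gamma_difference_def[abs_def]
    using assms by (intro tendsto_divide tendsto_const shifted_gamma_tendsto_at_0) auto
qed

text \<open>
  At \<open>x = 0\<close> the right-hand limit is the value of the integral itself, by
  \<open>gamma_difference_tendsto_at_0\<close>.
\<close>

lemma at_zero_tricomi_U:
  assumes "\<alpha> > 0" "\<beta> > 0" "x > 0 \<or> x = 0 \<and> \<alpha> + \<beta> > 1"
  shows "at_zero_by_limit (tricomi_U (1 - \<alpha>) (2 - \<alpha> - \<beta>)) x = Gamma \<alpha> * gamma_difference \<alpha> \<beta> x"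
proof (rule at_zero_by_limit_eqI)
  have "Gamma \<alpha> \<noteq> 0" using assms by (metis Gamma_real_pos less_irrefl)
  then show "tricomi_U (1 - \<alpha>) (2 - \<alpha> - \<beta>) y = Gamma \<alpha> * gamma_difference \<alpha> \<beta> y" if "y > 0" for y
    using tricomi_U_eq_shifted_gamma[of \<beta> y \<alpha>] assms that by (simp add: gamma_difference_def)
  show "((\<lambda>y. Gamma \<alpha> * gamma_difference \<alpha> \<beta> y) \<longlongrightarrow> Gamma \<alpha> * gamma_difference \<alpha> \<beta> 0) (at_right 0)" if "x = 0"
    using that assms by (intro tendsto_intros gamma_difference_tendsto_at_0) auto
qed (use assms in auto)

lemma at_zero_besselK:
  assumes "\<gamma> > 0" "x > 0 \<or> x = 0 \<and> \<gamma> > 1/2"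
  shows "at_zero_by_limit (\<lambda>y. y powr (\<gamma> - 1/2) * besselK (\<gamma> - 1/2) (y / 2)) x
       = sqrt pi * Gamma \<gamma> * (exp (- x / 2) * gamma_difference \<gamma> \<gamma> x)"
proof (rule at_zero_by_limit_eqI)
  have "Gamma \<gamma> \<noteq> 0" using assms by (metis Gamma_real_pos less_irrefl)
  then show "y powr (\<gamma> - 1/2) * besselK (\<gamma> - 1/2) (y / 2)
       = sqrt pi * Gamma \<gamma> * (exp (- y / 2) * gamma_difference \<gamma> \<gamma> y)" if "y > 0" for y
    using besselK_eq_shifted_gamma[of \<gamma> y] assms that by (simp add: gamma_difference_def)
  show "((\<lambda>y. sqrt pi * Gamma \<gamma> * (exp (- y / 2) * gamma_difference \<gamma> \<gamma> y)) \<longlongrightarrow>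
     sqrt pi * Gamma \<gamma> * (exp (- 0 / 2) * gamma_difference \<gamma> \<gamma> 0)) (at_right 0)" if "x = 0"
    using that assms by (intro tendsto_intros gamma_difference_tendsto_at_0) auto
qed (use assms in auto)

text \<open>
  The convolution formula for \<open>X + (- Y)\<close>, with the variable of integration reflected.
\<close>

lemma (in prob_space) distributed_diff:
  fixes f g :: "real \<Rightarrow> ennreal"
  assumes indep: "indep_var borel X borel Y"
    and X: "distributed M lborel X f" and Y: "distributed M lborel Y g"
  shows "distributed M lborel (\<lambda>\<omega>. X \<omega> - Y \<omega>) (\<lambda>x. \<integral>\<^sup>+v. f (v + x) * g v \<partial>lborel)"
proof -
  have [measurable]: "f \<in> borel_measurable borel" "g \<in> borel_measurable borel"
    using distributed_borel_measurable[OF X] distributed_borel_measurable[OF Y] by simp_all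
  have "distributed M lborel (\<lambda>\<omega>. 0 + (-1) * Y \<omega>) (\<lambda>y. g ((y - 0) / (-1)) / \<bar>-1 :: real\<bar>)"
    by (rule distributed_affine[OF Y]) simp
  then have Y': "distributed M lborel (\<lambda>\<omega>. - Y \<omega>) (\<lambda>y. g (- y))"
    by (simp add: divide_ennreal_def)
  have "indep_var borel ((\<lambda>x. x) \<circ> X) borel ((\<lambda>y. - y) \<circ> Y)"
    by (rule indep_var_compose[OF indep]) auto
  then have "indep_var borel X borel (\<lambda>\<omega>. - Y \<omega>)" by (simp add: comp_def)
  from distributed_convolution[OF this X Y']
  have "distributed M lborel (\<lambda>\<omega>. X \<omega> - Y \<omega>) (\<lambda>x. \<integral>\<^sup>+y. f (x - y) * g (- y) \<partial>lborel)" by simp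
  also have "(\<lambda>x. \<integral>\<^sup>+y. f (x - y) * g (- y) \<partial>lborel) = (\<lambda>x. \<integral>\<^sup>+v. f (v + x) * g v \<partial>lborel)"
    by (subst nn_integral_real_affine[where c = "-1" and t = 0]) (auto simp: add.commute)
  finally show ?thesis .
qed

lemma distributed_cong_AE:
  assumes "distributed M N X f" "AE x in N. f x = g x" "g \<in> borel_measurable N"
  shows "distributed M N X g"
  using assms unfolding distributed_def by (auto cong: density_cong)

theorem corollary2p3:
  fixes M :: "'a measure" and V\<^sub>1 V\<^sub>2 T :: "'a \<Rightarrow> real" and r l\<^sub>1 l\<^sub>2 :: real
  assumes "prob_space M"
    and "r > 0" and "l\<^sub>1 \<ge> 0" and "l\<^sub>2 \<ge> 0"
    and "distributed M lborel V\<^sub>1 (\<lambda>x. ennreal (nc_chi_square_density r l\<^sub>1 x))"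
    and "distributed M lborel V\<^sub>2 (\<lambda>x. ennreal (nc_chi_square_density r l\<^sub>2 x))"
    and "prob_space.indep_var M borel V\<^sub>1 borel V\<^sub>2"
    and "\<And>\<omega>. T \<omega> = V\<^sub>1 \<omega> - V\<^sub>2 \<omega>"
  shows "\<exists>p\<^sub>T :: real \<Rightarrow> real.
    (\<forall>x. p\<^sub>T x \<ge> 0) \<and> distributed M lborel T (\<lambda>x. ennreal (p\<^sub>T x)) \<and>
    (\<forall>x. (x \<noteq> 0 \<or> r > 1) \<longrightarrow>
      (let term1 = (\<lambda>k. \<Sum>j=0..k.
             1 / (fact k * Gamma (r / 2 + real (series_index j k x))) * real (k choose j)
             * (l\<^sub>1 / 4) ^ (k - j) * (l\<^sub>2 / 4) ^ j
             * at_zero_by_limit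
                 (tricomi_U (1 - r / 2 - real (series_index j k x)) (2 - r - real k)) \<bar>x\<bar>)
       in summable term1 \<and>
          p\<^sub>T x = 1 / 2 powr r * exp (- (\<bar>x\<bar> + l\<^sub>1 + l\<^sub>2) / 2) * (\<Sum>k. term1 k))) \<and>
    (\<forall>l. l\<^sub>1 = l \<and> l\<^sub>2 = l \<longrightarrow> (\<forall>x. (x \<noteq> 0 \<or> r > 1) \<longrightarrow>
      (let term2 = (\<lambda>k. (l / 4) ^ k / (fact k * Gamma (r / 2 + real k))
             * at_zero_by_limit
                 (\<lambda>y. y powr ((r - 1) / 2 + real k) * besselK ((r - 1) / 2 + real k) (y / 2)) \<bar>x\<bar>)
       in summable term2 \<and>
          p\<^sub>T x = 1 / (2 powr r * sqrt pi) * exp (- l) * (\<Sum>k. term2 k))))"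
proof -
  interpret prob_space M by fact
  note r = \<open>r > 0\<close> and l = \<open>l\<^sub>1 \<ge> 0\<close> \<open>l\<^sub>2 \<ge> 0\<close>
  let ?f\<^sub>1 = "\<lambda>x. ennreal (nc_chi_square_density r l\<^sub>1 x)"
  let ?f\<^sub>2 = "\<lambda>x. ennreal (nc_chi_square_density r l\<^sub>2 x)"
  have [measurable]: "?f\<^sub>1 \<in> borel_measurable borel" "?f\<^sub>2 \<in> borel_measurable borel"
    using assms(5,6)[THEN distributed_borel_measurable] by simp_all
  define I where "I = (\<lambda>x. \<integral>\<^sup>+v. ?f\<^sub>1 (v + x) * ?f\<^sub>2 v \<partial>lborel)"
  define t where "t = (\<lambda>x. if x \<ge> 0 then nc_difference_term r l\<^sub>1 l\<^sub>2 \<bar>x\<bar> else nc_difference_term r l\<^sub>2 l\<^sub>1 \<bar>x\<bar>)"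
  define P where "P = (\<lambda>x. 1 / 2 powr r * exp (- (\<bar>x\<bar> + l\<^sub>1 + l\<^sub>2) / 2))"
  have P: "P x > 0" for x by (simp add: P_def)

  \<comment> \<open>A shift of the variable of integration makes the shift in the other density positive when \<open>x < 0\<close>.\<close>
  have I_neg: "I x = (\<integral>\<^sup>+v. ?f\<^sub>2 (v - x) * ?f\<^sub>1 v \<partial>lborel)" for x
    unfolding I_def by (subst nn_integral_real_affine[where c = 1 and t = "- x"]) (auto simp: mult.commute)
  have series: "summable (t x) \<and> I x = ennreal (P x * suminf (t x)) \<and> (\<forall>k. t x k \<ge> 0)"
    if x: "x \<noteq> 0 \<or> r > 1" for x
  proof -
    have y: "\<bar>x\<bar> > 0 \<or> \<bar>x\<bar> = 0 \<and> r > 1" using x by auto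
    have P_eq: "P x = 2 powr (- r) * exp (- (\<bar>x\<bar> + l\<^sub>1 + l\<^sub>2) / 2)"
      by (simp add: P_def powr_minus_divide)
    also have "\<dots> = 2 powr (- r) * exp (- (\<bar>x\<bar> + l\<^sub>2 + l\<^sub>1) / 2)"
      by (simp add: add_ac)
    finally have P_eq': "P x = 2 powr (- r) * exp (- (\<bar>x\<bar> + l\<^sub>2 + l\<^sub>1) / 2)" .
    show ?thesis
    proof (cases "x \<ge> 0")
      case True
      then have eq: "t x = nc_difference_term r l\<^sub>1 l\<^sub>2 \<bar>x\<bar>" "I x = (\<integral>\<^sup>+v. ?f\<^sub>1 (v + \<bar>x\<bar>) * ?f\<^sub>2 v \<partial>lborel)"
        by (simp_all add: t_def I_def)
      show ?thesis unfolding eq P_eq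
        by (intro conjI allI nn_integral_nc_chi_square_correlation nc_difference_term_nonneg r l y)
    next
      case False
      then have eq: "t x = nc_difference_term r l\<^sub>2 l\<^sub>1 \<bar>x\<bar>" "I x = (\<integral>\<^sup>+v. ?f\<^sub>2 (v + \<bar>x\<bar>) * ?f\<^sub>1 v \<partial>lborel)"
        by (simp_all add: t_def I_neg)
      show ?thesis unfolding eq P_eq'
        by (intro conjI allI nn_integral_nc_chi_square_correlation nc_difference_term_nonneg r l y)
    qed
  qed
  define p where "p = (\<lambda>x. enn2real (I x))"
  have p_eq: "p x = P x * suminf (t x)" if "x \<noteq> 0 \<or> r > 1" for x
  proof -
    have "P x * suminf (t x) \<ge> 0"
      using series[OF that] by (intro mult_nonneg_nonneg suminf_nonneg less_imp_le[OF P]) auto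
    then show ?thesis using series[OF that] by (simp add: p_def)
  qed
  have "T = (\<lambda>\<omega>. V\<^sub>1 \<omega> - V\<^sub>2 \<omega>)" using assms(8) by (rule ext)
  then have "distributed M lborel T I"
    unfolding I_def using distributed_diff[OF assms(7,5,6)] by (simp only:)
  then have p_distributed: "distributed M lborel T (\<lambda>x. ennreal (p x))"
  proof (rule distributed_cong_AE)
    show "AE x in lborel. I x = ennreal (p x)"
      using AE_lborel_singleton[of 0]
      by eventually_elim (use series in \<open>auto simp: p_def\<close>)
    show "(\<lambda>x. ennreal (p x)) \<in> borel_measurable lborel"
      unfolding p_def I_def by measurable
  qed

  have part1: "(\<Sum>j=0..k. 1 / (fact k * Gamma (r / 2 + real (series_index j k x))) * real (k choose j)
             * (l\<^sub>1 / 4) ^ (k - j) * (l\<^sub>2 / 4) ^ j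
             * at_zero_by_limit
                 (tricomi_U (1 - r / 2 - real (series_index j k x)) (2 - r - real k)) \<bar>x\<bar>) = t x k"
    if x: "x \<noteq> 0 \<or> r > 1" for x k
  proof -
    have "t x k = (\<Sum>j\<le>k. real (k choose j) / fact k * (l\<^sub>1 / 4) ^ (k - j) * (l\<^sub>2 / 4) ^ j
         * gamma_difference (r / 2 + real (series_index j k x)) (r / 2 + real (k - series_index j k x)) \<bar>x\<bar>)"
    proof (cases "x \<ge> 0")
      case True
      then show ?thesis
        by (auto simp: t_def nc_difference_term_def series_index_def intro!: sum.cong)
    next
      case False
      then show ?thesis
        by (simp add: t_def nc_difference_term_swap series_index_def)
    qed
    also have "\<dots> = (\<Sum>j=0..k. 1 / (fact k * Gamma (r / 2 + real (series_index j k x))) * real (k choose j)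
             * (l\<^sub>1 / 4) ^ (k - j) * (l\<^sub>2 / 4) ^ j
             * at_zero_by_limit
                 (tricomi_U (1 - r / 2 - real (series_index j k x)) (2 - r - real k)) \<bar>x\<bar>)"
    proof (rule sum.cong)
      fix j assume "j \<in> {0..k}"
      define i where "i = series_index j k x"
      have i: "i \<le> k" using \<open>j \<in> {0..k}\<close> by (simp add: i_def series_index_def)
      have G: "Gamma (r / 2 + real i) \<noteq> 0" using r Gamma_real_pos[of "r / 2 + real i"] by linarith
      have a: "1 - r / 2 - real i = 1 - (r / 2 + real i)"
        and b: "2 - r - real k = 2 - (r / 2 + real i) - (r / 2 + real (k - i))"
        using i by (simp_all add: of_nat_diff)
      have "at_zero_by_limit (tricomi_U (1 - r / 2 - real i) (2 - r - real k)) \<bar>x\<bar>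
          = Gamma (r / 2 + real i) * gamma_difference (r / 2 + real i) (r / 2 + real (k - i)) \<bar>x\<bar>"
        unfolding a b using r x i by (intro at_zero_tricomi_U) (auto simp: of_nat_diff)
      then show "real (k choose j) / fact k * (l\<^sub>1 / 4) ^ (k - j) * (l\<^sub>2 / 4) ^ j
         * gamma_difference (r / 2 + real (series_index j k x)) (r / 2 + real (k - series_index j k x)) \<bar>x\<bar>
        = 1 / (fact k * Gamma (r / 2 + real (series_index j k x))) * real (k choose j)
             * (l\<^sub>1 / 4) ^ (k - j) * (l\<^sub>2 / 4) ^ j
             * at_zero_by_limit
                 (tricomi_U (1 - r / 2 - real (series_index j k x)) (2 - r - real k)) \<bar>x\<bar>"
        using G unfolding i_def[symmetric] by simp
    qed auto
    finally show ?thesis ..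
  qed

  have part2: "(l / 4) ^ k / (fact k * Gamma (r / 2 + real k))
             * at_zero_by_limit
                 (\<lambda>y. y powr ((r - 1) / 2 + real k) * besselK ((r - 1) / 2 + real k) (y / 2)) \<bar>x\<bar>
        = sqrt pi * exp (- \<bar>x\<bar> / 2) * t x k"
    if l: "l\<^sub>1 = l" "l\<^sub>2 = l" and x: "x \<noteq> 0 \<or> r > 1" for l x k
  proof -
    have G: "Gamma (r / 2 + real k) \<noteq> 0" using r Gamma_real_pos[of "r / 2 + real k"] by linarith
    have "(r - 1) / 2 + real k = r / 2 + real k - 1 / 2" by (simp add: field_simps)
    moreover have "\<bar>x\<bar> > 0 \<or> \<bar>x\<bar> = 0 \<and> r / 2 + real k > 1 / 2" "r / 2 + real k > 0" using r x by auto
    ultimately have "at_zero_by_limit (\<lambda>y. y powr ((r - 1) / 2 + real k) * besselK ((r - 1) / 2 + real k) (y / 2)) \<bar>x\<bar>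
        = sqrt pi * Gamma (r / 2 + real k) * (exp (- \<bar>x\<bar> / 2) * gamma_difference (r / 2 + real k) (r / 2 + real k) \<bar>x\<bar>)"
      by (simp only: at_zero_besselK)
    moreover have "t x k = (l / 4) ^ k / fact k * gamma_difference (r / 2 + real k) (r / 2 + real k) \<bar>x\<bar>"
      using nc_difference_term_equal[OF r, of "\<bar>x\<bar>" l k] x by (auto simp: t_def l)
    ultimately show ?thesis using G by simp
  qed

  show ?thesis
  proof (intro exI[of _ p] conjI allI impI)
    show "p x \<ge> 0" for x by (simp add: p_def)
    show "distributed M lborel T (\<lambda>x. ennreal (p x))" by (rule p_distributed)
  next
    fix x :: real assume x: "x \<noteq> 0 \<or> r > 1"
    show "let term1 = (\<lambda>k. \<Sum>j=0..k.
             1 / (fact k * Gamma (r / 2 + real (series_index j k x))) * real (k choose j)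
             * (l\<^sub>1 / 4) ^ (k - j) * (l\<^sub>2 / 4) ^ j
             * at_zero_by_limit
                 (tricomi_U (1 - r / 2 - real (series_index j k x)) (2 - r - real k)) \<bar>x\<bar>)
       in summable term1 \<and>
          p x = 1 / 2 powr r * exp (- (\<bar>x\<bar> + l\<^sub>1 + l\<^sub>2) / 2) * (\<Sum>k. term1 k)"
      unfolding part1[OF x] Let_def using series[OF x] p_eq[OF x] by (simp add: P_def)
  next
    fix l x :: real assume "l\<^sub>1 = l \<and> l\<^sub>2 = l" and x: "x \<noteq> 0 \<or> r > 1"
    then have ll: "l\<^sub>1 = l" "l\<^sub>2 = l" by auto
    have sm: "summable (t x)" using series[OF x] by simp
    have "P x = 1 / 2 powr r * (exp (- l) * exp (- \<bar>x\<bar> / 2))"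
      unfolding P_def ll exp_add[symmetric] by (simp add: field_simps)
    then have "p x = 1 / (2 powr r * sqrt pi) * exp (- l) * (sqrt pi * exp (- \<bar>x\<bar> / 2) * suminf (t x))"
      using p_eq[OF x] by simp
    then show "let term2 = (\<lambda>k. (l / 4) ^ k / (fact k * Gamma (r / 2 + real k))
             * at_zero_by_limit
                 (\<lambda>y. y powr ((r - 1) / 2 + real k) * besselK ((r - 1) / 2 + real k) (y / 2)) \<bar>x\<bar>)
       in summable term2 \<and>
          p x = 1 / (2 powr r * sqrt pi) * exp (- l) * (\<Sum>k. term2 k)"
      unfolding part2[OF ll x] Let_def using sm by (simp add: suminf_mult summable_mult)
  qed
qed

end
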